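(* Let the target process be deterministic and of the form $$\xi_t=\xi_0+g(t)+\sum_{j=1}^N\Delta_j\,\mathbf 1_{\{t\ge t_j\}},\qquad0\le t\le T,$$ where $\xi_0\in\mathbb R$, $N\ge0$, $\Delta_1,\dots,\Delta_N\in\mathbb R$, $g\in H^1(0,T)$, $g(0)=0$, and the jump times satisfy $0<t_1<\cdots<t_N<T$. Then $$v(\kappa)=\sqrt\kappa\Big(\frac12(x-\xi_0)^2+\frac14\sum_{j=1}^N\Delta_j^2\Big)+o(\sqrt\kappa),\qquad\kappa\downarrow0.$$ In particular, whenever $x\ne\xi_0$ or at least one jump $\Delta_j$ is nonzero, the generic $\sqrt\kappa$ rate cannot be improved.
   Context: Fix $T>0$, a filtered probability space $(\Omega,\mathcal F,(\mathcal F_t)_{0\le t\le T},\mathbb P)$ satisfying the usual conditions, and $x\in\mathbb R$. Let $\mathcal U$ be the set of progressively measurable processes $u=(u_t)_{0\le t\le T}$ with $\mathbb E\int_0^T u_t^2\,dt<\infty$, and for $u\in\mathcal U$ let $X^u_t=x+\int_0^t u_s\,ds$. For $\kappa\ge0$, $$J_\kappa(u)=\mathbb E\Big[\tfrac12\int_0^T(X^u_t-\xi_t)^2\,dt+\tfrac{\kappa}{2}\int_0^Tu_t^2\,dt\Big],\qquad v(\kappa)=\inf_{u\in\mathcal U}J_\kappa(u).$$ $H^1(0,T)$ is the Sobolev space of $g\in L^2(0,T)$ admitting an absolutely continuous representative on $[0,T]$ with derivative $\dot g\in L^2(0,T)$; $g$ is identified with this representative. *)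

theory Defs
  imports "HOL-Probability.Probability"
begin

section \<open>Filtered probability spaces on a finite horizon\<close>

text \<open>The time set is the interval from \<open>0\<close> to \<open>T\<close>.  Filtrations and processes are indexed by
  all reals, but only their values at times in this interval are ever used; in particular the
  library locale \<open>filtration\<close> is instantiated with the family frozen at its endpoints.\<close>

locale usual_filtered_prob_space = prob_space M + complete_measure M
  for M :: "'a measure" +
  fixes F :: "real \<Rightarrow> 'a measure" and T :: real
  assumes horizon_pos: "0 < T"
    and filtration: "filtration (space M) (\<lambda>t. F (max 0 (min T t)))"
    and subalgebra: "\<And>t. t \<in> {0..T} \<Longrightarrow> subalgebra M (F t)"
    and null_sets_initial: "null_sets M \<subseteq> sets (F 0)"
    and right_continuous: "\<And>t. t \<in> {0..<T} \<Longrightarrow> sets (F t) = (\<Inter>s\<in>{t<..T}. sets (F s))"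

definition progressively_measurable ::
  "(real \<Rightarrow> 'a measure) \<Rightarrow> real \<Rightarrow> (real \<Rightarrow> 'a \<Rightarrow> real) \<Rightarrow> bool" where
  "progressively_measurable F T u \<longleftrightarrow>
    (\<forall>t\<in>{0..T}. (\<lambda>(s, \<omega>). u s \<omega>)
        \<in> borel_measurable (restrict_space borel {0..t} \<Otimes>\<^sub>M F t))"


section \<open>The tracking problem\<close>

definition admissible_controls ::
  "'a measure \<Rightarrow> (real \<Rightarrow> 'a measure) \<Rightarrow> real \<Rightarrow> (real \<Rightarrow> 'a \<Rightarrow> real) set" where
  "admissible_controls M F T =
    {u. progressively_measurable F T u \<and>
        (\<integral>\<^sup>+\<omega>. (\<integral>\<^sup>+t\<in>{0..T}. ennreal ((u t \<omega>)\<^sup>2) \<partial>lborel) \<partial>M) < \<infinity>}"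

definition controlled_state ::
  "real \<Rightarrow> (real \<Rightarrow> 'a \<Rightarrow> real) \<Rightarrow> real \<Rightarrow> 'a \<Rightarrow> real" where
  "controlled_state x u t \<omega> = x + (LINT s:{0..t}|lborel. u s \<omega>)"

text \<open>Cost and value are extended nonnegative, so that no integrability has to be presupposed.
  The weight \<open>\<kappa>\<close> is meant to be nonnegative (\<open>ennreal\<close> truncates negative reals to \<open>0\<close>).\<close>

definition tracking_cost ::
  "'a measure \<Rightarrow> real \<Rightarrow> real \<Rightarrow> (real \<Rightarrow> 'a \<Rightarrow> real) \<Rightarrow> real \<Rightarrow> (real \<Rightarrow> 'a \<Rightarrow> real) \<Rightarrow> ennreal" where
  "tracking_cost M T x \<xi> \<kappa> u =
    (\<integral>\<^sup>+\<omega>. (ennreal (1/2) * (\<integral>\<^sup>+t\<in>{0..T}. ennreal ((controlled_state x u t \<omega> - \<xi> t \<omega>)\<^sup>2) \<partial>lborel)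
          + ennreal (\<kappa>/2) * (\<integral>\<^sup>+t\<in>{0..T}. ennreal ((u t \<omega>)\<^sup>2) \<partial>lborel)) \<partial>M)"

definition tracking_value ::
  "'a measure \<Rightarrow> (real \<Rightarrow> 'a measure) \<Rightarrow> real \<Rightarrow> real \<Rightarrow> (real \<Rightarrow> 'a \<Rightarrow> real) \<Rightarrow> real \<Rightarrow> ennreal" where
  "tracking_value M F T x \<xi> \<kappa> = (INF u\<in>admissible_controls M F T. tracking_cost M T x \<xi> \<kappa> u)"


section \<open>The Sobolev space of order one on an interval\<close>

definition abs_continuous_interval :: "real \<Rightarrow> real \<Rightarrow> (real \<Rightarrow> real) \<Rightarrow> bool" where
  "abs_continuous_interval a b f \<longleftrightarrow>
    (\<forall>\<epsilon>>0. \<exists>\<delta>>0. \<forall>D. finite D \<longrightarrow> (\<forall>(c, d)\<in>D. a \<le> c \<and> c \<le> d \<and> d \<le> b) \<longrightarrow>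
        disjoint_family_on (\<lambda>(c, d). {c<..<d}) D \<longrightarrow>
        (\<Sum>(c, d)\<in>D. d - c) < \<delta> \<longrightarrow> (\<Sum>(c, d)\<in>D. \<bar>f d - f c\<bar>) < \<epsilon>)"

definition square_integrable_interval :: "real \<Rightarrow> real \<Rightarrow> (real \<Rightarrow> real) \<Rightarrow> bool" where
  "square_integrable_interval a b f \<longleftrightarrow>
    set_borel_measurable lborel {a<..<b} f \<and> set_integrable lborel {a<..<b} (\<lambda>t. (f t)\<^sup>2)"

text \<open>Elements are represented by their absolutely continuous representatives on the closed
  interval; values outside the interval are unconstrained.\<close>

definition sobolev_H1 :: "real \<Rightarrow> real \<Rightarrow> (real \<Rightarrow> real) set" where
  "sobolev_H1 a b =
    {g. square_integrable_interval a b g \<and> abs_continuous_interval a b g \<and>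
        (\<exists>g'. square_integrable_interval a b g' \<and>
              (AE t in lborel. t \<in> {a<..<b} \<longrightarrow> (g has_real_derivative g' t) (at t)))}"

end

theory Submission
  imports Defs "HOL-Real_Asymp.Real_Asymp"
begin

text \<open>The problem is solved path by path. Let \<open>S\<close> be the jump part of the target and
  \<open>\<epsilon> = sqrt \<kappa>\<close>. Superposing exponential layers of width \<open>\<epsilon>\<close> at \<open>0\<close> and at the jump times gives
  functions \<open>\<zeta>\<close> and \<open>q\<close> with \<open>q' = \<zeta> - S\<close>, \<open>\<zeta>' = q / \<kappa>\<close> and \<open>\<zeta> 0 = x - \<xi>\<^sub>0\<close>. The control
  \<open>g' + q / \<kappa>\<close> then has tracking error \<open>\<zeta> - S\<close>. Expanding the convex cost around it, the
  first-order term involves only the Euler-Lagrange residual \<open>\<kappa> g' + q T\<close>, and completing the square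
  shows that no path improves the cost by more than \<open>O(\<kappa>)\<close> plus an exponentially small term. Up to
  \<open>o(\<epsilon>)\<close> the cost of this control is half the integral of \<open>(\<zeta> - S)\<^sup>2 + q\<^sup>2 / \<kappa>\<close>, which is
  computed exactly by integrating \<open>(q \<zeta>)'\<close>, so no cross terms between layers have to be
  estimated.\<close>

section \<open>Absolutely continuous functions\<close>

text \<open>Tags in the exceptional set are confined by the gauge to an open set of measure less than the
  modulus of absolute continuity, so their increments are negligible; this avoids Lebesgue's
  differentiation theorem.\<close>

lemma abs_continuous_interval_has_integral:
  fixes f f' :: "real \<Rightarrow> real"
  assumes ab: "a \<le> b" and ac: "abs_continuous_interval a b f" and S: "negligible S"
    and deriv: "\<And>x. x \<in> {a..b} - S \<Longrightarrow> (f has_real_derivative f' x) (at x within {a..b})"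
  shows "(f' has_integral (f b - f a)) {a..b}"
proof -
  \<comment> \<open>\<open>h\<close> vanishes on \<open>S\<close>, so a tag in \<open>S\<close>
    contributes only the increment of \<open>f\<close> to the error; \<open>f'\<close> is restored
    at the end by the spike rule.\<close>
  define h where "h = (\<lambda>x. if x \<in> S then 0 else f' x)"
  have "(h has_integral (f b - f a)) {a..b}"
    unfolding has_integral_real
  proof (intro allI impI)
    fix e :: real assume e: "e > 0"
    \<comment> \<open>The local errors at good tags add up to at most \<open>e1 * (b - a)\<close>;
      the \<open>+ 1\<close> keeps this strictly below \<open>e / 2\<close> and also covers
      \<open>a = b\<close>.\<close>
    define e1 where "e1 = e / (2 * (b - a + 1))"
    have e1: "e1 > 0" "e1 * (b - a) < e / 2"
      using e ab by (auto simp: e1_def field_simps)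
    have "\<forall>x. \<exists>d>0. x \<in> {a..b} - S \<longrightarrow>
        (\<forall>y\<in>{a..b}. norm (y - x) < d \<longrightarrow> norm (f y - f x - (y - x) * f' x) \<le> e1 * norm (y - x))"
    proof
      fix x
      show "\<exists>d>0. x \<in> {a..b} - S \<longrightarrow>
        (\<forall>y\<in>{a..b}. norm (y - x) < d \<longrightarrow> norm (f y - f x - (y - x) * f' x) \<le> e1 * norm (y - x))"
      proof (cases "x \<in> {a..b} - S")
        case True
        then have "(f has_derivative (\<lambda>y. y * f' x)) (at x within {a..b})"
          using deriv[OF True] by (simp add: has_field_derivative_def mult_commute_abs)
        with e1(1) show ?thesis
          unfolding has_derivative_within_alt by blast
      qed (auto intro: exI[of _ 1])
    qed
    from choice[OF this] obtain d where d01: "\<forall>x. 0 < d x \<and> (x \<in> {a..b} - S \<longrightarrow>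
        (\<forall>y\<in>{a..b}. norm (y - x) < d x \<longrightarrow> norm (f y - f x - (y - x) * f' x) \<le> e1 * norm (y - x)))"
      by blast
    have d: "0 < d x" "x \<in> {a..b} - S \<Longrightarrow> y \<in> {a..b} \<Longrightarrow> norm (y - x) < d x \<Longrightarrow>
         norm (f y - f x - (y - x) * f' x) \<le> e1 * norm (y - x)" for x y
      using d01 by simp_all
    from ac e obtain \<delta> where \<delta>: "\<delta> > 0" "\<forall>D. finite D \<longrightarrow> (\<forall>(c, d)\<in>D. a \<le> c \<and> c \<le> d \<and> d \<le> b) \<longrightarrow>
        disjoint_family_on (\<lambda>(c, d). {c<..<d}) D \<longrightarrow>
        (\<Sum>(c, d)\<in>D. d - c) < \<delta> \<longrightarrow> (\<Sum>(c, d)\<in>D. \<bar>f d - f c\<bar>) < e / 2"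
      unfolding abs_continuous_interval_def by (elim allE[of _ "e / 2"]) auto
    have Sl: "S \<in> sets lebesgue"
      using S by (rule negligible_imp_sets)
    obtain U where U: "open U" "S \<subseteq> U" "U - S \<in> lmeasurable" "emeasure lebesgue (U - S) < ennreal \<delta>"
      using sets_lebesgue_outer_open[OF Sl \<delta>(1)] by blast
    have "emeasure lebesgue U = emeasure lebesgue (U - S)"
      using S U(1) Sl by (intro emeasure_Diff_null_set[symmetric]) (auto simp: negligible_iff_null_sets)
    with U have Um: "emeasure lborel U < ennreal \<delta>"
      by simp
    define \<gamma> where "\<gamma> = (\<lambda>x. if x \<in> S then U else ball x (d x))"
    have "gauge \<gamma>"
      using d(1) U by (auto simp: gauge_def \<gamma>_def)
    moreover have "norm ((\<Sum>(x, K)\<in>p. measure lborel K *\<^sub>R h x) - (f b - f a)) < e"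
      if p: "p tagged_division_of {a..b}" "\<gamma> fine p" for p
    proof -
      have ptag: "p tagged_division_of cbox a b"
        using p by simp
      note pD = tagged_division_ofD[OF p(1)]
      have finp: "finite p" by (rule pD)
      have ba: "b - a = (\<Sum>(x,K)\<in>p. Sup K - Inf K)" "f b - f a = (\<Sum>(x,K)\<in>p. f (Sup K) - f (Inf K))"
        using additive_tagged_division_1[where f="\<lambda>x. x"] additive_tagged_division_1[where f=f] ab p(1)
        by auto
      have K: "{Inf K..Sup K} = K" "Inf K \<le> Sup K" "a \<le> Inf K" "Sup K \<le> b" "x \<in> {Inf K..Sup K}"
        if xK: "(x, K) \<in> p" for x K
      proof -
        obtain u v where uv: "K = {u..v}" using pD(4)[OF xK] by auto
        have "x \<in> {u..v}" "{u..v} \<subseteq> {a..b}" using pD(2,3)[OF xK] uv by auto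
        then show "{Inf K..Sup K} = K" "Inf K \<le> Sup K" "a \<le> Inf K" "Sup K \<le> b" "x \<in> {Inf K..Sup K}"
          using uv by (auto simp: interval_bounds_real)
      qed
      \<comment> \<open>\<open>r\<close> is the error on one tagged interval. The increments of
        \<open>f\<close> telescope over the division, so the sum of \<open>r\<close> is the quantity
        to bound; good tags and tags in \<open>S\<close> each get a share
        \<open>e / 2\<close>.\<close>
      define r where "r = (\<lambda>(x, K). measure lborel K *\<^sub>R h x - (f (Sup K) - f (Inf K)))"
      define B where "B = {(x, K) \<in> p. x \<in> S}"
      \<comment> \<open>Degenerate intervals carry no increment. On the others the interiors are
        nonempty and disjoint, so passing to endpoint pairs by \<open>\<iota>\<close> is injective
        and the sum can be taken over a set \<open>D\<close>, as absolute continuity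
        requires.\<close>
      define B' where "B' = {(x, K) \<in> B. Inf K < Sup K}"
      have Bp: "B \<subseteq> p" and B'B: "B' \<subseteq> B" by (auto simp: B_def B'_def)
      have finB: "finite B" "finite B'" using finp Bp B'B by (auto intro: finite_subset)
      have good: "\<bar>r xK\<bar> \<le> e1 * (Sup (snd xK) - Inf (snd xK))" if "xK \<in> p - B" for xK
      proof -
        obtain x K where xK: "xK = (x, K)" by (cases xK)
        then have xKp: "(x, K) \<in> p" and xS: "x \<notin> S" using that by (auto simp: B_def)
        define u v where "u = Inf K" and "v = Sup K"
        have uv: "K = {u..v}" "u \<le> v" "a \<le> u" "v \<le> b" "x \<in> {u..v}"
          unfolding u_def v_def using K[OF xKp] by simp_all
        have "K \<subseteq> ball x (d x)"
          using fineD[OF p(2) xKp] xS by (simp add: \<gamma>_def)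
        moreover have "u \<in> K" "v \<in> K" using uv by auto
        ultimately have "u \<in> ball x (d x)" "v \<in> ball x (d x)" by blast+
        then have du: "norm (u - x) < d x" "norm (v - x) < d x" by (auto simp: dist_real_def)
        \<comment> \<open>Differentiability at the tag compares both end values with
          \<open>f x\<close>. As \<open>x\<close> lies between \<open>u\<close> and
          \<open>v\<close>, the two bounds add up to exactly \<open>e1 * (v - u)\<close>.\<close>
        have "norm (f u - f x - (u - x) * f' x) \<le> e1 * norm (u - x)"
          "norm (f v - f x - (v - x) * f' x) \<le> e1 * norm (v - x)"
          by (rule d(2); use uv xS du in simp)+
        moreover have "e1 * norm (u - x) = e1 * (x - u)" "e1 * norm (v - x) = e1 * (v - x)"
          using uv by auto
        ultimately have "\<bar>(v - u) * f' x - (f v - f u)\<bar> \<le> e1 * (x - u) + e1 * (v - x)"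
          unfolding real_norm_def by (auto simp: algebra_simps abs_le_iff)
        also have "\<dots> = e1 * (v - u)" by (simp add: algebra_simps)
        moreover have "r xK = (v - u) * f' x - (f v - f u)"
          using uv xS by (simp add: r_def h_def xK interval_bounds_real)
        moreover have "Sup (snd xK) - Inf (snd xK) = v - u"
          using xK by (simp add: u_def v_def)
        ultimately show ?thesis by simp
      qed
      have "\<bar>\<Sum>xK\<in>p - B. r xK\<bar> \<le> (\<Sum>xK\<in>p - B. e1 * (Sup (snd xK) - Inf (snd xK)))"
        by (rule order_trans[OF sum_abs]) (rule sum_mono, rule good)
      also have "\<dots> \<le> (\<Sum>xK\<in>p. e1 * (Sup (snd xK) - Inf (snd xK)))"
        using finp e1 K by (intro sum_mono2) (auto simp: split_beta)
      also have "\<dots> = e1 * (b - a)"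
        unfolding ba sum_distrib_left by (intro sum.cong) auto
      finally have 1: "\<bar>\<Sum>xK\<in>p - B. r xK\<bar> < e / 2" using e1 by simp
      define \<iota> :: "real \<times> real set \<Rightarrow> real \<times> real" where "\<iota> = (\<lambda>(x, K). (Inf K, Sup K))"
      have disj: "{Inf K<..<Sup K} \<inter> {Inf K'<..<Sup K'} = {}"
        if "(x, K) \<in> p" "(x', K') \<in> p" "(x, K) \<noteq> (x', K')" for x K x' K'
      proof -
        have "interior K \<inter> interior K' = {}" by (rule pD(5)[OF that])
        moreover have "interior K = {Inf K<..<Sup K}" "interior K' = {Inf K'<..<Sup K'}"
          using K(1)[OF that(1)] K(1)[OF that(2)] by (metis interior_atLeastAtMost_real)+
        ultimately show ?thesis by simp
      qed
      have inj: "inj_on \<iota> B'"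
      proof (rule inj_onI)
        fix y z assume y: "y \<in> B'" and z: "z \<in> B'" and eq: "\<iota> y = \<iota> z"
        show "y = z"
        proof (rule ccontr)
          assume "y \<noteq> z"
          obtain x K x' K' where yz: "y = (x, K)" "z = (x', K')" by (metis surj_pair)
          have "{Inf K<..<Sup K} \<inter> {Inf K'<..<Sup K'} = {}"
            using disj y z yz \<open>y \<noteq> z\<close> by (auto simp: B_def B'_def)
          moreover have "Inf K = Inf K'" "Sup K = Sup K'" "Inf K < Sup K"
            using eq y yz by (auto simp: \<iota>_def B'_def)
          ultimately show False by auto
        qed
      qed
      define D where "D = \<iota> ` B'"
      have finD: "finite D" using finB by (simp add: D_def)
      have D1: "\<forall>(c, d)\<in>D. a \<le> c \<and> c \<le> d \<and> d \<le> b"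
        using K by (auto simp: D_def \<iota>_def B'_def B_def)
      have D2: "disjoint_family_on (\<lambda>(c, d). {c<..<d}) D"
        unfolding disjoint_family_on_def
      proof (intro ballI impI)
        fix y z assume "y \<in> D" "z \<in> D" "y \<noteq> z"
        then obtain x K x' K' where "(x, K) \<in> B'" "(x', K') \<in> B'"
          and yz: "y = (Inf K, Sup K)" "z = (Inf K', Sup K')"
          by (auto simp: D_def \<iota>_def)
        moreover have "(x, K) \<noteq> (x', K')" using yz \<open>y \<noteq> z\<close> by auto
        ultimately have "{Inf K<..<Sup K} \<inter> {Inf K'<..<Sup K'} = {}"
          by (intro disj) (auto simp: B_def B'_def)
        then show "(case y of (c, d) \<Rightarrow> {c<..<d}) \<inter> (case z of (c, d) \<Rightarrow> {c<..<d}) = {}"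
          using yz by simp
      qed
      \<comment> \<open>The intervals of \<open>D\<close> are disjoint and, being fine around tags
        in \<open>S\<close>, lie in \<open>U\<close>; their total length is thus at most the measure
        of \<open>U\<close>.\<close>
      have D3: "(\<Sum>(c, d)\<in>D. d - c) < \<delta>"
      proof -
        have sub: "(\<Union>y\<in>D. case y of (c, d) \<Rightarrow> {c<..<d}) \<subseteq> U"
        proof (rule UN_least)
          fix y assume "y \<in> D"
          then obtain x K where "(x, K) \<in> B'" and y: "y = (Inf K, Sup K)"
            by (auto simp: D_def \<iota>_def)
          then have xK: "(x, K) \<in> p" "x \<in> S" by (auto simp: B_def B'_def)
          then have "K \<subseteq> U" using fineD[OF p(2) xK(1)] by (simp add: \<gamma>_def)
          moreover have "{Inf K<..<Sup K} \<subseteq> K"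
            by (subst (3) K(1)[OF xK(1), symmetric]) auto
          ultimately show "(case y of (c, d) \<Rightarrow> {c<..<d}) \<subseteq> U" using y by auto
        qed
        have "ennreal (\<Sum>(c, d)\<in>D. d - c) = (\<Sum>y\<in>D. ennreal (case y of (c, d) \<Rightarrow> d - c))"
          using D1 by (intro sum_ennreal[symmetric]) auto
        also have "\<dots> = (\<Sum>y\<in>D. emeasure lborel (case y of (c, d) \<Rightarrow> {c<..<d}))"
          using D1 by (intro sum.cong) auto
        also have "\<dots> = emeasure lborel (\<Union>y\<in>D. case y of (c, d) \<Rightarrow> {c<..<d})"
          using D2 finD by (intro sum_emeasure) auto
        also have "\<dots> \<le> emeasure lborel U"
          using U(1) sub by (intro emeasure_mono) auto
        also have "\<dots> < ennreal \<delta>" by (rule Um)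
        finally show ?thesis
          by (metis \<delta>(1) ennreal_less_iff leI le_less_trans less_imp_le)
      qed
      have "\<bar>\<Sum>xK\<in>B. r xK\<bar> \<le> (\<Sum>xK\<in>B. \<bar>f (Sup (snd xK)) - f (Inf (snd xK))\<bar>)"
        by (rule order_trans[OF sum_abs], rule sum_mono) (auto simp: r_def h_def B_def)
      also have "\<dots> = (\<Sum>xK\<in>B'. \<bar>f (Sup (snd xK)) - f (Inf (snd xK))\<bar>)"
      proof (rule sum.mono_neutral_right[OF finB(1) B'B])
        show "\<forall>xK\<in>B - B'. \<bar>f (Sup (snd xK)) - f (Inf (snd xK))\<bar> = 0"
          using K by (fastforce simp: B'_def B_def)
      qed
      also have "\<dots> = (\<Sum>(c, d)\<in>D. \<bar>f d - f c\<bar>)"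
        unfolding D_def by (subst sum.reindex[OF inj]) (auto intro!: sum.cong simp: \<iota>_def)
      also have "\<dots> < e / 2"
        using \<delta>(2) finD D1 D2 D3 by simp
      finally have 2: "\<bar>\<Sum>xK\<in>B. r xK\<bar> < e / 2" .
      have "(\<Sum>(x, K)\<in>p. measure lborel K *\<^sub>R h x) - (f b - f a) = (\<Sum>xK\<in>p. r xK)"
        unfolding ba r_def by (simp add: sum_subtractf split_beta)
      also have "\<dots> = (\<Sum>xK\<in>p - B. r xK) + (\<Sum>xK\<in>B. r xK)"
        by (rule sum.subset_diff[OF Bp finp])
      finally show ?thesis using 1 2 by simp
    qed
    ultimately show "\<exists>\<gamma>. gauge \<gamma> \<and> (\<forall>p. p tagged_division_of {a..b} \<and> \<gamma> fine p \<longrightarrow>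
        norm ((\<Sum>(x, K)\<in>p. measure lborel K *\<^sub>R h x) - (f b - f a)) < e)"
      by (intro exI[of _ \<gamma>]) simp
  qed
  then show ?thesis
    by (rule has_integral_spike[OF S, rotated]) (auto simp: h_def)
qed

section \<open>Square-integrable functions and Sobolev primitives\<close>

lemma integrable_mult_of_squares:
  fixes f g :: "'a \<Rightarrow> real"
  assumes [measurable]: "f \<in> borel_measurable M" "g \<in> borel_measurable M"
    and "integrable M (\<lambda>x. (f x)\<^sup>2)" "integrable M (\<lambda>x. (g x)\<^sup>2)"
  shows "integrable M (\<lambda>x. f x * g x)"
proof (rule Bochner_Integration.integrable_bound)
  show "integrable M (\<lambda>x. (f x)\<^sup>2 + (g x)\<^sup>2)"
    using assms by auto
  have "\<bar>a * b\<bar> \<le> a\<^sup>2 + b\<^sup>2" for a b :: real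
    using sum_squares_bound[of "\<bar>a\<bar>" "\<bar>b\<bar>"] abs_ge_zero[of "a * b"]
    unfolding abs_mult power2_abs mult.assoc by linarith
  then show "AE x in M. norm (f x * g x) \<le> norm ((f x)\<^sup>2 + (g x)\<^sup>2)"
    by simp
qed measurable

lemma integrable_square_lincomb:
  fixes f g :: "'a \<Rightarrow> real"
  assumes "f \<in> borel_measurable M" "g \<in> borel_measurable M"
    and "integrable M (\<lambda>x. (f x)\<^sup>2)" "integrable M (\<lambda>x. (g x)\<^sup>2)"
  shows "integrable M (\<lambda>x. (a * f x + b * g x)\<^sup>2)"
proof -
  have "integrable M (\<lambda>x. a\<^sup>2 * (f x)\<^sup>2 + 2 * a * b * (f x * g x) + b\<^sup>2 * (g x)\<^sup>2)"
    using assms integrable_mult_of_squares[OF assms] by auto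
  then show ?thesis by (simp add: power2_sum power_mult_distrib mult_ac add_ac)
qed

lemma integrable_indicator_Icc: "integrable lborel (indicat_real {a..b::real})"
  by (rule integrable_real_indicator) (auto simp: emeasure_lborel_Icc_eq)

text \<open>Finite length turns square integrability into integrability: \<open>h\<close> is its own
  product with the square-integrable indicator of the interval.\<close>

lemma integrable_of_square_compact_support:
  fixes h :: "real \<Rightarrow> real"
  assumes [measurable]: "h \<in> borel_measurable borel" and "integrable lborel (\<lambda>t. (h t)\<^sup>2)"
    and "\<And>t. t \<notin> {a..b} \<Longrightarrow> h t = 0"
  shows "integrable lborel h"
proof -
  have "integrable lborel (\<lambda>t. indicator {a..b} t * h t)"
  proof (rule integrable_mult_of_squares)
    have "(\<lambda>t. (indicat_real {a..b} t)\<^sup>2) = indicat_real {a..b}"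
      by (auto simp: indicator_def)
    then show "integrable lborel (\<lambda>t. (indicat_real {a..b} t)\<^sup>2)"
      using integrable_indicator_Icc by simp
  qed (use assms(2) in auto)
  moreover have "indicator {a..b} t * h t = h t" for t
    using assms(3)[of t] by (cases "t \<in> {a..b}") auto
  ultimately show ?thesis by simp
qed

lemma abs_continuous_interval_subset:
  assumes "abs_continuous_interval a b f" "b' \<le> b"
  shows "abs_continuous_interval a b' f"
  unfolding abs_continuous_interval_def
proof (intro allI impI)
  fix \<epsilon> :: real assume "\<epsilon> > 0"
  then obtain \<delta> where \<delta>: "\<delta> > 0" "\<forall>D. finite D \<longrightarrow> (\<forall>(c, d)\<in>D. a \<le> c \<and> c \<le> d \<and> d \<le> b) \<longrightarrow>
        disjoint_family_on (\<lambda>(c, d). {c<..<d}) D \<longrightarrow>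
        (\<Sum>(c, d)\<in>D. d - c) < \<delta> \<longrightarrow> (\<Sum>(c, d)\<in>D. \<bar>f d - f c\<bar>) < \<epsilon>"
    using assms(1) unfolding abs_continuous_interval_def by (elim allE[of _ \<epsilon>]) auto
  have "(\<forall>(c, d)\<in>D. a \<le> c \<and> c \<le> d \<and> d \<le> b)" if "\<forall>(c, d)\<in>D. a \<le> c \<and> c \<le> d \<and> d \<le> b'" for D
    using that assms(2) by force
  with \<delta> show "\<exists>\<delta>>0. \<forall>D. finite D \<longrightarrow> (\<forall>(c, d)\<in>D. a \<le> c \<and> c \<le> d \<and> d \<le> b') \<longrightarrow>
        disjoint_family_on (\<lambda>(c, d). {c<..<d}) D \<longrightarrow>
        (\<Sum>(c, d)\<in>D. d - c) < \<delta> \<longrightarrow> (\<Sum>(c, d)\<in>D. \<bar>f d - f c\<bar>) < \<epsilon>"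
    by (intro exI[of _ \<delta>]) simp
qed

text \<open>The only form in which the Sobolev hypothesis enters later. The almost-everywhere
  derivative is extended by zero, so that subsequent integrals can run over the whole line, and
  absolute continuity recovers \<open>g\<close> from it.\<close>

lemma sobolev_H1_primitive:
  assumes g: "g \<in> sobolev_H1 0 T" and g0: "g 0 = 0"
  obtains dg where "dg \<in> borel_measurable borel" "integrable lborel (\<lambda>t. (dg t)\<^sup>2)"
    "\<And>t. t \<notin> {0..T} \<Longrightarrow> dg t = 0"
    "\<And>t. t \<in> {0..T} \<Longrightarrow> g t = (\<integral>s. indicator {..t} s * dg s \<partial>lborel)"
proof -
  obtain g' where ac: "abs_continuous_interval 0 T g"
    and meas: "set_borel_measurable lborel {0<..<T} g'"
    and int: "set_integrable lborel {0<..<T} (\<lambda>t. (g' t)\<^sup>2)"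
    and ae: "AE t in lborel. t \<in> {0<..<T} \<longrightarrow> (g has_real_derivative g' t) (at t)"
    using g by (auto simp: sobolev_H1_def square_integrable_interval_def)
  \<comment> \<open>The cutoff is at the open interval because measurability of \<open>g'\<close> is
    known only there.\<close>
  define dg where "dg = (\<lambda>t. indicator {0<..<T} t * g' t)"
  have dgm[measurable]: "dg \<in> borel_measurable borel"
    using meas by (simp add: set_borel_measurable_def dg_def)
  have "(dg t)\<^sup>2 = indicator {0<..<T} t *\<^sub>R (g' t)\<^sup>2" for t
    by (simp add: dg_def indicator_def)
  then have dg_sq: "integrable lborel (\<lambda>t. (dg t)\<^sup>2)"
    using int by (simp add: set_integrable_def)
  have supp: "dg t = 0" if "t \<notin> {0..T}" for t
    using that by (auto simp: dg_def indicator_def)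
  have dg_int: "integrable lborel dg"
    by (rule integrable_of_square_compact_support[OF dgm dg_sq supp])
  obtain S where S: "S \<in> null_sets lborel"
    "{t. \<not> (t \<in> {0<..<T} \<longrightarrow> (g has_real_derivative g' t) (at t))} \<subseteq> S"
    using ae by (auto simp: eventually_ae_filter)
  \<comment> \<open>The end points join the null set: the derivative is given in the open interval
    only, and there \<open>dg\<close> equals \<open>g'\<close>.\<close>
  have negl: "negligible (insert 0 (insert T S))"
    using S(1) by (auto simp: negligible_iff_null_sets intro: null_sets_completionI)
  have prim: "g t = (\<integral>s. indicator {..t} s * dg s \<partial>lborel)" if t: "t \<in> {0..T}" for t
  proof -
    have "(dg has_integral (g t - g 0)) {0..t}"
    proof (rule abs_continuous_interval_has_integral[OF _ _ negl])
      fix s assume s: "s \<in> {0..t} - insert 0 (insert T S)"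
      then have "s \<in> {0<..<T}" using t by auto
      moreover from this have "(g has_real_derivative g' s) (at s)" using S(2) s by blast
      ultimately show "(g has_real_derivative dg s) (at s within {0..t})"
        by (simp add: dg_def has_field_derivative_at_within)
    qed (use t ac abs_continuous_interval_subset in auto)
    moreover have "set_integrable lborel {0..t} dg"
      unfolding set_integrable_def by (intro integrable_mult_indicator dg_int) simp
    ultimately have "(LINT s:{0..t}|lborel. dg s) = g t"
      using set_borel_integral_eq_integral(2)[of "{0..t}" dg] g0 by (simp add: integral_unique)
    moreover have "(LINT s:{0..t}|lborel. dg s) = (\<integral>s. indicator {..t} s * dg s \<partial>lborel)"
      unfolding set_lebesgue_integral_def
      by (intro Bochner_Integration.integral_cong) (auto simp: dg_def indicator_def)
    ultimately show ?thesis by simp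
  qed
  show ?thesis
    by (rule that[OF dgm dg_sq supp prim])
qed

section \<open>Pathwise expansion of the cost\<close>

text \<open>Integration by parts in the form of Fubini over the triangle \<open>s \<le> t\<close>,
  dominated by the full product \<open>z t * h s\<close>. It turns a pairing with a state
  perturbation into a pairing with a control perturbation.\<close>

lemma integral_mult_primitive:
  fixes z h :: "real \<Rightarrow> real"
  assumes z: "integrable lborel z" and h: "integrable lborel h"
  shows "integrable lborel (\<lambda>t. z t * (\<integral>s. indicator {..t} s * h s \<partial>lborel))"
    and "(\<integral>t. z t * (\<integral>s. indicator {..t} s * h s \<partial>lborel) \<partial>lborel)
      = (\<integral>s. (\<integral>t. indicator {s..} t * z t \<partial>lborel) * h s \<partial>lborel)"
proof -
  have [measurable]: "z \<in> borel_measurable borel" "h \<in> borel_measurable borel"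
    using z h by auto
  define f where "f = (\<lambda>t s. z t * h s * (if s \<le> t then 1 else (0::real)))"
  have prod: "integrable (lborel \<Otimes>\<^sub>M lborel) (\<lambda>(t, s). z t * h s)"
  proof (rule lborel_pair.Fubini_integrable)
    show "integrable lborel (\<lambda>t. \<integral>s. norm (case (t, s) of (t, s) \<Rightarrow> z t * h s) \<partial>lborel)"
      using z by (simp add: abs_mult)
    show "AE t in lborel. integrable lborel (\<lambda>s. case (t, s) of (t, s) \<Rightarrow> z t * h s)"
      using h by simp
  qed measurable
  have int: "integrable (lborel \<Otimes>\<^sub>M lborel) (case_prod f)"
  proof (rule Bochner_Integration.integrable_bound[OF prod])
    show "case_prod f \<in> borel_measurable (lborel \<Otimes>\<^sub>M lborel)"
      unfolding f_def by measurable
  qed (auto simp: f_def)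
  have ft: "(\<integral>s. f t s \<partial>lborel) = z t * (\<integral>s. indicator {..t} s * h s \<partial>lborel)" for t
  proof -
    have "(\<integral>s. f t s \<partial>lborel) = (\<integral>s. z t * (indicator {..t} s * h s) \<partial>lborel)"
      by (intro Bochner_Integration.integral_cong) (auto simp: f_def indicator_def)
    then show ?thesis by simp
  qed
  have fs: "(\<integral>t. f t s \<partial>lborel) = (\<integral>t. indicator {s..} t * z t \<partial>lborel) * h s" for s
  proof -
    have "(\<integral>t. f t s \<partial>lborel) = (\<integral>t. (indicator {s..} t * z t) * h s \<partial>lborel)"
      by (intro Bochner_Integration.integral_cong) (auto simp: f_def indicator_def)
    then show ?thesis by simp
  qed
  show "integrable lborel (\<lambda>t. z t * (\<integral>s. indicator {..t} s * h s \<partial>lborel))"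
    using lborel_pair.integrable_fst[OF int] by (simp add: ft)
  show "(\<integral>t. z t * (\<integral>s. indicator {..t} s * h s \<partial>lborel) \<partial>lborel)
      = (\<integral>s. (\<integral>t. indicator {s..} t * z t \<partial>lborel) * h s \<partial>lborel)"
    using lborel_pair.Fubini_integral[OF int] by (simp add: ft fs)
qed

text \<open>The linear term of the quadratic expansion around \<^term>\<open>u\<^sub>0\<close> is the pairing of
  \<^term>\<open>u - u\<^sub>0\<close> with the Euler-Lagrange residual \<^term>\<open>e\<close>; completing the square absorbs it.\<close>

lemma tracking_path_lower_bound:
  fixes z u\<^sub>0 u e :: "real \<Rightarrow> real"
  assumes \<kappa>: "\<kappa> > 0"
    and [measurable]: "z \<in> borel_measurable borel" "u\<^sub>0 \<in> borel_measurable borel"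
      "u \<in> borel_measurable borel" "e \<in> borel_measurable borel"
    and sq: "integrable lborel (\<lambda>t. (z t)\<^sup>2)" "integrable lborel (\<lambda>t. (u\<^sub>0 t)\<^sup>2)"
      "integrable lborel (\<lambda>t. (u t)\<^sup>2)" "integrable lborel (\<lambda>t. (e t)\<^sup>2)"
    and supp: "\<And>t. t \<notin> {0..T} \<Longrightarrow> z t = 0" "\<And>t. t \<notin> {0..T} \<Longrightarrow> u\<^sub>0 t = 0"
      "\<And>t. t \<notin> {0..T} \<Longrightarrow> u t = 0"
    and e: "\<And>s. s \<in> {0..T} \<Longrightarrow> (\<integral>t. indicator {s..} t * z t \<partial>lborel) + \<kappa> * u\<^sub>0 s = e s"
  defines "w \<equiv> \<lambda>t. \<integral>s. indicator {..t} s * (u s - u\<^sub>0 s) \<partial>lborel"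
  shows "integrable lborel (\<lambda>t. indicator {0..T} t * (z t + w t)\<^sup>2)"
    and "(\<integral>t. (z t)\<^sup>2 \<partial>lborel) / 2 + \<kappa> / 2 * (\<integral>t. (u\<^sub>0 t)\<^sup>2 \<partial>lborel) - (\<integral>t. (e t)\<^sup>2 \<partial>lborel) / (2 * \<kappa>)
      \<le> (\<integral>t. indicator {0..T} t * (z t + w t)\<^sup>2 \<partial>lborel) / 2 + \<kappa> / 2 * (\<integral>t. (u t)\<^sup>2 \<partial>lborel)"
proof -
  define h where "h = (\<lambda>t. u t - u\<^sub>0 t)"
  have [measurable]: "h \<in> borel_measurable borel" by (simp add: h_def)
  have hsq: "integrable lborel (\<lambda>t. (h t)\<^sup>2)"
    using integrable_square_lincomb[of u lborel u\<^sub>0 1 "-1"] sq by (simp add: h_def)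
  have zi: "integrable lborel z"
    by (rule integrable_of_square_compact_support[where a=0 and b=T]) (use sq supp in auto)
  have hi: "integrable lborel h"
    by (rule integrable_of_square_compact_support[where a=0 and b=T]) (use hsq supp in \<open>auto simp: h_def\<close>)
  have w: "w = (\<lambda>t. \<integral>s. indicator {..t} s * h s \<partial>lborel)"
    by (simp add: w_def h_def)
  have wm[measurable]: "w \<in> borel_measurable borel"
  proof -
    \<comment> \<open>The indicator is written as a conditional because its set depends on
      \<open>t\<close>; joint measurability can then be derived.\<close>
    have "(\<lambda>t. \<integral>s. (if s \<le> t then 1 else 0) * h s \<partial>lborel) \<in> borel_measurable borel"
      by measurable
    also have "(\<lambda>t. \<integral>s. (if s \<le> t then 1 else 0) * h s \<partial>lborel) = w"
      unfolding w by (intro ext Bochner_Integration.integral_cong) (auto simp: indicator_def)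
    finally show ?thesis .
  qed
  have wb: "\<bar>w t\<bar> \<le> (\<integral>s. \<bar>h s\<bar> \<partial>lborel)" for t
  proof -
    have "\<bar>w t\<bar> \<le> (\<integral>s. \<bar>indicator {..t} s * h s\<bar> \<partial>lborel)"
      unfolding w by (rule integral_abs_bound)
    also have "\<dots> \<le> (\<integral>s. \<bar>h s\<bar> \<partial>lborel)"
      using hi by (intro integral_mono) (auto simp: indicator_def integrable_mult_indicator abs_mult
          intro!: Bochner_Integration.integrable_bound[OF hi])
    finally show ?thesis .
  qed
  have wsq: "integrable lborel (\<lambda>t. indicator {0..T} t * (w t)\<^sup>2)"
  proof (rule Bochner_Integration.integrable_bound)
    show "integrable lborel (\<lambda>t. indicator {0..T} t * (\<integral>s. \<bar>h s\<bar> \<partial>lborel)\<^sup>2)"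
      by (intro integrable_mult_left integrable_indicator_Icc)
    show "AE t in lborel. norm (indicator {0..T} t * (w t)\<^sup>2) \<le> norm (indicator {0..T} t * (\<integral>s. \<bar>h s\<bar> \<partial>lborel)\<^sup>2)"
      using wb by (auto simp: indicator_def abs_le_square_iff[symmetric] intro: order_trans[OF _ abs_ge_self])
  qed measurable
  have zw: "integrable lborel (\<lambda>t. z t * w t)"
    and zw_eq: "(\<integral>t. z t * w t \<partial>lborel) = (\<integral>s. (\<integral>t. indicator {s..} t * z t \<partial>lborel) * h s \<partial>lborel)"
    using integral_mult_primitive[OF zi hi] by (simp_all add: w)
  \<comment> \<open>Only the last term keeps the cutoff: \<open>z\<close> vanishes off
    \<open>{0..T}\<close>, whereas \<open>w\<close> may be a nonzero constant after
    \<open>T\<close>.\<close>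
  have expand: "indicator {0..T} t * (z t + w t)\<^sup>2 = (z t)\<^sup>2 + 2 * (z t * w t) + indicator {0..T} t * (w t)\<^sup>2" for t
    using supp(1)[of t] by (cases "t \<in> {0..T}") (auto simp: power2_sum algebra_simps)
  show int: "integrable lborel (\<lambda>t. indicator {0..T} t * (z t + w t)\<^sup>2)"
    unfolding expand using sq zw wsq by auto
  have eh: "integrable lborel (\<lambda>t. e t * h t)" and u0h: "integrable lborel (\<lambda>t. u\<^sub>0 t * h t)"
    using sq hsq by (auto intro!: integrable_mult_of_squares)
  have "(\<integral>t. z t * w t \<partial>lborel) = (\<integral>t. e t * h t - \<kappa> * (u\<^sub>0 t * h t) \<partial>lborel)"
    unfolding zw_eq
  proof (intro Bochner_Integration.integral_cong refl)
    fix s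
    \<comment> \<open>On \<open>{0..T}\<close> this is the residual equation \<open>e\<close>;
      elsewhere both sides vanish together with \<open>h\<close>.\<close>
    show "(\<integral>t. indicator {s..} t * z t \<partial>lborel) * h s = e s * h s - \<kappa> * (u\<^sub>0 s * h s)"
    proof (cases "s \<in> {0..T}")
      case True
      then have "(\<integral>t. indicator {s..} t * z t \<partial>lborel) = e s - \<kappa> * u\<^sub>0 s"
        using e[OF True] by simp
      then show ?thesis by (simp only: left_diff_distrib mult.assoc)
    qed (use supp[of s] in \<open>auto simp: h_def\<close>)
  qed
  also have "\<dots> = (\<integral>t. e t * h t \<partial>lborel) - \<kappa> * (\<integral>t. u\<^sub>0 t * h t \<partial>lborel)"
    using eh u0h by simp
  finally have zw_eq2: "(\<integral>t. z t * w t \<partial>lborel) = (\<integral>t. e t * h t \<partial>lborel) - \<kappa> * (\<integral>t. u\<^sub>0 t * h t \<partial>lborel)" .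
  have "(\<integral>t. indicator {0..T} t * (z t + w t)\<^sup>2 \<partial>lborel)
      = (\<integral>t. (z t)\<^sup>2 \<partial>lborel) + 2 * (\<integral>t. z t * w t \<partial>lborel) + (\<integral>t. indicator {0..T} t * (w t)\<^sup>2 \<partial>lborel)"
    unfolding expand using sq zw wsq by simp
  \<comment> \<open>The square of \<open>w\<close> is discarded; the square of \<open>h\<close> from
    the control cost suffices to absorb the linear term.\<close>
  moreover have "(\<integral>t. indicator {0..T} t * (w t)\<^sup>2 \<partial>lborel) \<ge> 0"
    by (intro integral_nonneg_AE) auto
  ultimately have 1: "(\<integral>t. indicator {0..T} t * (z t + w t)\<^sup>2 \<partial>lborel)
      \<ge> (\<integral>t. (z t)\<^sup>2 \<partial>lborel) + 2 * ((\<integral>t. e t * h t \<partial>lborel) - \<kappa> * (\<integral>t. u\<^sub>0 t * h t \<partial>lborel))"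
    using zw_eq2 by simp
  have "(\<integral>t. (u t)\<^sup>2 \<partial>lborel) = (\<integral>t. (u\<^sub>0 t)\<^sup>2 + 2 * (u\<^sub>0 t * h t) + (h t)\<^sup>2 \<partial>lborel)"
    by (intro Bochner_Integration.integral_cong) (auto simp: h_def power2_eq_square algebra_simps)
  also have "\<dots> = (\<integral>t. (u\<^sub>0 t)\<^sup>2 \<partial>lborel) + 2 * (\<integral>t. u\<^sub>0 t * h t \<partial>lborel) + (\<integral>t. (h t)\<^sup>2 \<partial>lborel)"
    using sq u0h hsq by simp
  finally have 2: "(\<integral>t. (u t)\<^sup>2 \<partial>lborel)
      = (\<integral>t. (u\<^sub>0 t)\<^sup>2 \<partial>lborel) + 2 * (\<integral>t. u\<^sub>0 t * h t \<partial>lborel) + (\<integral>t. (h t)\<^sup>2 \<partial>lborel)" .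
  \<comment> \<open>Multiplied by \<open>\<kappa> / 2\<close>, this square bounds the linear term
    plus the energy of \<open>h\<close> from below by minus the energy of \<open>e\<close> over
    \<open>2 * \<kappa>\<close>.\<close>
  have "0 \<le> (\<integral>t. (e t / \<kappa> + h t)\<^sup>2 \<partial>lborel)"
    by (intro integral_nonneg_AE) auto
  also have "\<dots> = (\<integral>t. (e t)\<^sup>2 / \<kappa>\<^sup>2 + 2 / \<kappa> * (e t * h t) + (h t)\<^sup>2 \<partial>lborel)"
    by (intro Bochner_Integration.integral_cong) (auto simp: power2_sum power_divide)
  also have "\<dots> = (\<integral>t. (e t)\<^sup>2 \<partial>lborel) / \<kappa>\<^sup>2 + 2 / \<kappa> * (\<integral>t. e t * h t \<partial>lborel) + (\<integral>t. (h t)\<^sup>2 \<partial>lborel)"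
    using sq eh hsq by simp
  finally have nonneg: "0 \<le> \<dots>" .
  have "\<kappa> / 2 * (E / \<kappa>\<^sup>2 + 2 / \<kappa> * P + H) = E / (2 * \<kappa>) + P + \<kappa> / 2 * H" for E P H
    using \<kappa> by (simp add: field_simps power2_eq_square)
  with mult_nonneg_nonneg[OF _ nonneg, of "\<kappa> / 2"] \<kappa>
  have 3: "0 \<le> (\<integral>t. (e t)\<^sup>2 \<partial>lborel) / (2 * \<kappa>) + (\<integral>t. e t * h t \<partial>lborel) + \<kappa> / 2 * (\<integral>t. (h t)\<^sup>2 \<partial>lborel)"
    by simp
  show "(\<integral>t. (z t)\<^sup>2 \<partial>lborel) / 2 + \<kappa> / 2 * (\<integral>t. (u\<^sub>0 t)\<^sup>2 \<partial>lborel) - (\<integral>t. (e t)\<^sup>2 \<partial>lborel) / (2 * \<kappa>)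
      \<le> (\<integral>t. indicator {0..T} t * (z t + w t)\<^sup>2 \<partial>lborel) / 2 + \<kappa> / 2 * (\<integral>t. (u t)\<^sup>2 \<partial>lborel)"
    using 1 3 unfolding 2 by (simp add: algebra_simps)
qed

section \<open>The cost of a single path\<close>

text \<open>The integrand of \<open>tracking_cost\<close> in one scenario. Extended nonnegative
  values accommodate paths of infinite energy.\<close>

definition path_cost :: "real \<Rightarrow> real \<Rightarrow> (real \<Rightarrow> real) \<Rightarrow> real \<Rightarrow> (real \<Rightarrow> real) \<Rightarrow> ennreal" where
  "path_cost T x r \<kappa> u =
    ennreal (1/2) * (\<integral>\<^sup>+t\<in>{0..T}. ennreal ((x + (LINT s:{0..t}|lborel. u s) - r t)\<^sup>2) \<partial>lborel)
    + ennreal (\<kappa>/2) * (\<integral>\<^sup>+t\<in>{0..T}. ennreal ((u t)\<^sup>2) \<partial>lborel)"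

lemma tracking_cost_eq_path_cost:
  "tracking_cost M T x \<xi> \<kappa> u = (\<integral>\<^sup>+\<omega>. path_cost T x (\<lambda>t. \<xi> t \<omega>) \<kappa> (\<lambda>t. u t \<omega>) \<partial>M)"
  by (simp add: tracking_cost_def path_cost_def controlled_state_def)

lemma path_cost_cong:
  assumes "\<And>t. t \<in> {0..T} \<Longrightarrow> r t = r' t"
  shows "path_cost T x r \<kappa> u = path_cost T x r' \<kappa> u"
proof -
  have "(\<integral>\<^sup>+t\<in>{0..T}. ennreal ((x + (LINT s:{0..t}|lborel. u s) - r t)\<^sup>2) \<partial>lborel)
    = (\<integral>\<^sup>+t\<in>{0..T}. ennreal ((x + (LINT s:{0..t}|lborel. u s) - r' t)\<^sup>2) \<partial>lborel)"
    using assms by (intro nn_integral_cong) (auto simp: indicator_def)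
  then show ?thesis by (simp add: path_cost_def)
qed

lemma set_nn_integral_ennreal_eq:
  assumes "integrable M (\<lambda>t. indicator A t * f t)" "\<And>t. 0 \<le> f t"
  shows "(\<integral>\<^sup>+t\<in>A. ennreal (f t) \<partial>M) = ennreal (\<integral>t. indicator A t * f t \<partial>M)"
proof -
  have "(\<integral>\<^sup>+t\<in>A. ennreal (f t) \<partial>M) = (\<integral>\<^sup>+t. ennreal (indicator A t * f t) \<partial>M)"
    by (intro nn_integral_cong) (auto simp: indicator_def)
  also have "\<dots> = ennreal (\<integral>t. indicator A t * f t \<partial>M)"
    using assms by (intro nn_integral_eq_integral) auto
  finally show ?thesis .
qed

lemma ennreal_weighted_sum:
  assumes "0 \<le> a" "0 \<le> b" "0 \<le> c" "0 \<le> d"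
  shows "ennreal a * ennreal c + ennreal b * ennreal d = ennreal (a * c + b * d)"
  using assms by (simp add: ennreal_mult)

text \<open>Infinite energy makes the cost infinite. Otherwise \<open>u\<close>, cut off outside
  \<open>{0..T}\<close>, can be inserted into \<open>tracking_path_lower_bound\<close>, and its
  tracking error is \<open>z\<close> plus the primitive of the control difference. Measurability of
  \<open>u\<close> is asked exactly where a path of an admissible process provides it.\<close>

lemma path_cost_ge:
  fixes z u\<^sub>0 u e :: "real \<Rightarrow> real"
  assumes \<kappa>: "\<kappa> > 0"
    and [measurable]: "z \<in> borel_measurable borel" "u\<^sub>0 \<in> borel_measurable borel" "e \<in> borel_measurable borel"
    and sq: "integrable lborel (\<lambda>t. (z t)\<^sup>2)" "integrable lborel (\<lambda>t. (u\<^sub>0 t)\<^sup>2)"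
      "integrable lborel (\<lambda>t. (e t)\<^sup>2)"
    and supp: "\<And>t. t \<notin> {0..T} \<Longrightarrow> z t = 0" "\<And>t. t \<notin> {0..T} \<Longrightarrow> u\<^sub>0 t = 0"
    and e: "\<And>s. s \<in> {0..T} \<Longrightarrow> (\<integral>t. indicator {s..} t * z t \<partial>lborel) + \<kappa> * u\<^sub>0 s = e s"
    and z: "\<And>t. t \<in> {0..T} \<Longrightarrow> z t = x + (\<integral>s. indicator {..t} s * u\<^sub>0 s \<partial>lborel) - r t"
    and u: "u \<in> borel_measurable (restrict_space borel {0..T})"
  shows "ennreal ((\<integral>t. (z t)\<^sup>2 \<partial>lborel) / 2 + \<kappa> / 2 * (\<integral>t. (u\<^sub>0 t)\<^sup>2 \<partial>lborel)
      - (\<integral>t. (e t)\<^sup>2 \<partial>lborel) / (2 * \<kappa>)) \<le> path_cost T x r \<kappa> u"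
proof (cases "(\<integral>\<^sup>+t\<in>{0..T}. ennreal ((u t)\<^sup>2) \<partial>lborel) = \<infinity>")
  case True
  then show ?thesis
    using \<kappa> by (simp add: path_cost_def ennreal_mult_top)
next
  case False
  define v where "v = (\<lambda>t. indicator {0..T} t * u t)"
  have vm[measurable]: "v \<in> borel_measurable borel"
    using u by (simp add: v_def borel_measurable_restrict_space_iff)
  have vsq_eq: "(\<lambda>t. (v t)\<^sup>2) = (\<lambda>t. indicator {0..T} t * (u t)\<^sup>2)"
    by (auto simp: v_def indicator_def)
  have "(\<integral>\<^sup>+t. ennreal ((v t)\<^sup>2) \<partial>lborel) = (\<integral>\<^sup>+t\<in>{0..T}. ennreal ((u t)\<^sup>2) \<partial>lborel)"
    by (intro nn_integral_cong) (auto simp: v_def indicator_def)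
  also have "\<dots> < \<infinity>" using False by (simp add: top.not_eq_extremum)
  finally have vsq: "integrable lborel (\<lambda>t. (v t)\<^sup>2)"
    by (intro integrableI_bounded) auto
  have vs: "v t = 0" if "t \<notin> {0..T}" for t using that by (simp add: v_def)
  have ui: "integrable lborel u\<^sub>0" and vi: "integrable lborel v"
    by (rule integrable_of_square_compact_support[where a=0 and b=T]; use sq supp vsq vs in simp)+
  define w where "w = (\<lambda>t. \<integral>s. indicator {..t} s * (v s - u\<^sub>0 s) \<partial>lborel)"
  have wt: "w t = (\<integral>s. indicator {..t} s * (v s - u\<^sub>0 s) \<partial>lborel)" for t
    by (simp add: w_def)
  note low = tracking_path_lower_bound[where z=z and u\<^sub>0=u\<^sub>0 and u=v and e=e and T=T and \<kappa>=\<kappa>,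
      OF \<kappa> assms(2,3) vm assms(4) sq(1,2) vsq sq(3) supp vs e, folded wt]
  have state: "x + (LINT s:{0..t}|lborel. u s) - r t = z t + w t" if t: "t \<in> {0..T}" for t
  proof -
    have "(LINT s:{0..t}|lborel. u s) = (\<integral>s. indicator {..t} s * v s \<partial>lborel)"
      unfolding set_lebesgue_integral_def
      using t by (intro Bochner_Integration.integral_cong) (auto simp: v_def indicator_def)
    moreover have "w t = (\<integral>s. indicator {..t} s * v s \<partial>lborel) - (\<integral>s. indicator {..t} s * u\<^sub>0 s \<partial>lborel)"
      unfolding w_def right_diff_distrib
      using integrable_mult_indicator[OF _ ui, of "{..t}"] integrable_mult_indicator[OF _ vi, of "{..t}"]
      by (intro Bochner_Integration.integral_diff) auto
    ultimately show ?thesis using z[OF t] by simp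
  qed
  have "path_cost T x r \<kappa> u = ennreal (1/2) * (\<integral>\<^sup>+t\<in>{0..T}. ennreal ((z t + w t)\<^sup>2) \<partial>lborel)
     + ennreal (\<kappa>/2) * (\<integral>\<^sup>+t\<in>{0..T}. ennreal ((u t)\<^sup>2) \<partial>lborel)"
  proof -
    have "(\<integral>\<^sup>+t\<in>{0..T}. ennreal ((x + (LINT s:{0..t}|lborel. u s) - r t)\<^sup>2) \<partial>lborel)
       = (\<integral>\<^sup>+t\<in>{0..T}. ennreal ((z t + w t)\<^sup>2) \<partial>lborel)"
      using state by (intro nn_integral_cong) (auto simp: indicator_def)
    then show ?thesis by (simp add: path_cost_def)
  qed
  also have "\<dots> = ennreal ((\<integral>t. indicator {0..T} t * (z t + w t)\<^sup>2 \<partial>lborel) / 2 + \<kappa> / 2 * (\<integral>t. (v t)\<^sup>2 \<partial>lborel))"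
  proof -
    have 1: "(\<integral>\<^sup>+t\<in>{0..T}. ennreal ((z t + w t)\<^sup>2) \<partial>lborel) = ennreal (\<integral>t. indicator {0..T} t * (z t + w t)\<^sup>2 \<partial>lborel)"
      by (rule set_nn_integral_ennreal_eq) (use low(1) in auto)
    have 2: "(\<integral>\<^sup>+t\<in>{0..T}. ennreal ((u t)\<^sup>2) \<partial>lborel) = ennreal (\<integral>t. (v t)\<^sup>2 \<partial>lborel)"
      unfolding vsq_eq by (rule set_nn_integral_ennreal_eq) (use vsq in \<open>auto simp: vsq_eq\<close>)
    have "0 \<le> (\<integral>t. indicator {0..T} t * (z t + w t)\<^sup>2 \<partial>lborel)" "0 \<le> (\<integral>t. (v t)\<^sup>2 \<partial>lborel)"
      by (intro integral_nonneg_AE; simp)+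
    then show ?thesis
      unfolding 1 2 using \<kappa> by (subst ennreal_weighted_sum) auto
  qed
  finally show ?thesis
    using low(2) by (simp add: ennreal_leI)
qed

text \<open>The matching upper side: the reference control attains the bound of
  \<open>path_cost_ge\<close> up to the residual term.\<close>

lemma path_cost_eq:
  fixes z u\<^sub>0 :: "real \<Rightarrow> real"
  assumes \<kappa>: "\<kappa> \<ge> 0"
    and sq: "integrable lborel (\<lambda>t. (z t)\<^sup>2)" "integrable lborel (\<lambda>t. (u\<^sub>0 t)\<^sup>2)"
    and supp: "\<And>t. t \<notin> {0..T} \<Longrightarrow> z t = 0" "\<And>t. t \<notin> {0..T} \<Longrightarrow> u\<^sub>0 t = 0"
    and z: "\<And>t. t \<in> {0..T} \<Longrightarrow> z t = x + (\<integral>s. indicator {..t} s * u\<^sub>0 s \<partial>lborel) - r t"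
  shows "path_cost T x r \<kappa> u\<^sub>0 = ennreal ((\<integral>t. (z t)\<^sup>2 \<partial>lborel) / 2 + \<kappa> / 2 * (\<integral>t. (u\<^sub>0 t)\<^sup>2 \<partial>lborel))"
proof -
  have ind: "(\<lambda>t. indicator {0..T} t * (z t)\<^sup>2) = (\<lambda>t. (z t)\<^sup>2)"
      "(\<lambda>t. indicator {0..T} t * (u\<^sub>0 t)\<^sup>2) = (\<lambda>t. (u\<^sub>0 t)\<^sup>2)"
    using supp by (auto simp: indicator_def fun_eq_iff)
  have state: "x + (LINT s:{0..t}|lborel. u\<^sub>0 s) - r t = z t" if t: "t \<in> {0..T}" for t
  proof -
    have "(LINT s:{0..t}|lborel. u\<^sub>0 s) = (\<integral>s. indicator {..t} s * u\<^sub>0 s \<partial>lborel)"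
      unfolding set_lebesgue_integral_def
      using t supp(2) by (intro Bochner_Integration.integral_cong) (auto simp: indicator_def)
    then show ?thesis using z[OF t] by simp
  qed
  have "(\<integral>\<^sup>+t\<in>{0..T}. ennreal ((x + (LINT s:{0..t}|lborel. u\<^sub>0 s) - r t)\<^sup>2) \<partial>lborel)
      = (\<integral>\<^sup>+t\<in>{0..T}. ennreal ((z t)\<^sup>2) \<partial>lborel)"
    using state by (intro nn_integral_cong) (auto simp: indicator_def)
  also have "\<dots> = ennreal (\<integral>t. (z t)\<^sup>2 \<partial>lborel)"
    by (subst set_nn_integral_ennreal_eq) (use sq in \<open>auto simp: ind\<close>)
  finally have 1: "(\<integral>\<^sup>+t\<in>{0..T}. ennreal ((x + (LINT s:{0..t}|lborel. u\<^sub>0 s) - r t)\<^sup>2) \<partial>lborel)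
      = ennreal (\<integral>t. (z t)\<^sup>2 \<partial>lborel)" .
  have 2: "(\<integral>\<^sup>+t\<in>{0..T}. ennreal ((u\<^sub>0 t)\<^sup>2) \<partial>lborel) = ennreal (\<integral>t. (u\<^sub>0 t)\<^sup>2 \<partial>lborel)"
    by (subst set_nn_integral_ennreal_eq) (use sq in \<open>auto simp: ind\<close>)
  have "0 \<le> (\<integral>t. (z t)\<^sup>2 \<partial>lborel)" "0 \<le> (\<integral>t. (u\<^sub>0 t)\<^sup>2 \<partial>lborel)"
    by (intro integral_nonneg_AE; simp)+
  then show ?thesis
    unfolding path_cost_def 1 2 using \<kappa> 
    by (subst ennreal_weighted_sum) auto
qed

section \<open>Reduction of the stochastic problem to single paths\<close>

context usual_filtered_prob_space
begin

lemma space_F: "t \<in> {0..T} \<Longrightarrow> space (F t) = space M"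
  using subalgebra by (simp add: subalgebra_def)

lemma deterministic_control_admissible:
  fixes c :: "real \<Rightarrow> real"
  assumes [measurable]: "c \<in> borel_measurable borel" and "integrable lborel (\<lambda>t. (c t)\<^sup>2)"
  shows "(\<lambda>t \<omega>. c t) \<in> admissible_controls M F T"
proof -
  have "progressively_measurable F T (\<lambda>t \<omega>. c t)"
    unfolding progressively_measurable_def
  proof
    fix t
    have "c \<in> borel_measurable (restrict_space borel {0..t})"
      by (rule measurable_restrict_space1) measurable
    from measurable_compose[OF measurable_fst this]
    show "(\<lambda>(s, \<omega>). c s) \<in> borel_measurable (restrict_space borel {0..t} \<Otimes>\<^sub>M F t)"
      by (simp add: split_beta')
  qed
  moreover have "(\<integral>\<^sup>+t\<in>{0..T}. ennreal ((c t)\<^sup>2) \<partial>lborel) < \<infinity>"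
  proof -
    have "(\<integral>\<^sup>+t\<in>{0..T}. ennreal ((c t)\<^sup>2) \<partial>lborel) \<le> (\<integral>\<^sup>+t. ennreal ((c t)\<^sup>2) \<partial>lborel)"
      by (intro nn_integral_mono) (auto simp: indicator_def)
    also have "\<dots> < \<infinity>"
      using assms(2) by (simp add: integrable_iff_bounded)
    finally show ?thesis .
  qed
  ultimately show ?thesis
    by (simp add: admissible_controls_def emeasure_space_1)
qed

text \<open>Progressive measurability at the horizon \<open>T\<close> is joint measurability in time
  and scenario, and sections of jointly measurable functions are measurable.\<close>

lemma admissible_control_path_measurable:
  assumes "u \<in> admissible_controls M F T" "\<omega> \<in> space M"
  shows "(\<lambda>t. u t \<omega>) \<in> borel_measurable (restrict_space borel {0..T})"
proof -
  have T: "T \<in> {0..T}" using horizon_pos by simp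
  have "(\<lambda>(s, \<omega>). u s \<omega>) \<in> borel_measurable (restrict_space borel {0..T} \<Otimes>\<^sub>M F T)"
    using assms(1) T by (auto simp: admissible_controls_def progressively_measurable_def)
  from measurable_Pair1[OF this, of \<omega>] show ?thesis
    using assms(2) space_F[OF T] by simp
qed

text \<open>A deterministic control has the same cost in every scenario, and the total mass is
  one.\<close>

lemma tracking_value_le:
  fixes c r :: "real \<Rightarrow> real"
  assumes "\<And>t \<omega>. t \<in> {0..T} \<Longrightarrow> \<omega> \<in> space M \<Longrightarrow> \<xi> t \<omega> = r t"
    and "c \<in> borel_measurable borel" "integrable lborel (\<lambda>t. (c t)\<^sup>2)"
  shows "tracking_value M F T x \<xi> \<kappa> \<le> path_cost T x r \<kappa> c"
proof -
  have "tracking_value M F T x \<xi> \<kappa> \<le> tracking_cost M T x \<xi> \<kappa> (\<lambda>t \<omega>. c t)"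
    unfolding tracking_value_def using assms by (intro INF_lower deterministic_control_admissible)
  also have "\<dots> = (\<integral>\<^sup>+\<omega>. path_cost T x r \<kappa> c \<partial>M)"
    unfolding tracking_cost_eq_path_cost
    using assms(1) by (intro nn_integral_cong path_cost_cong) auto
  also have "\<dots> = path_cost T x r \<kappa> c"
    by (simp add: emeasure_space_1)
  finally show ?thesis .
qed

text \<open>Randomization gains nothing against a deterministic target: a bound valid for every path
  survives taking the expectation.\<close>

lemma tracking_value_ge:
  fixes r :: "real \<Rightarrow> real"
  assumes "\<And>t \<omega>. t \<in> {0..T} \<Longrightarrow> \<omega> \<in> space M \<Longrightarrow> \<xi> t \<omega> = r t"
    and "\<And>u. u \<in> borel_measurable (restrict_space borel {0..T}) \<Longrightarrow> C \<le> path_cost T x r \<kappa> u"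
  shows "C \<le> tracking_value M F T x \<xi> \<kappa>"
  unfolding tracking_value_def
proof (rule INF_greatest)
  fix u assume u: "u \<in> admissible_controls M F T"
  have "C = (\<integral>\<^sup>+\<omega>. C \<partial>M)"
    by (simp add: emeasure_space_1)
  also have "\<dots> \<le> (\<integral>\<^sup>+\<omega>. path_cost T x (\<lambda>t. \<xi> t \<omega>) \<kappa> (\<lambda>t. u t \<omega>) \<partial>M)"
  proof (rule nn_integral_mono)
    fix \<omega> assume \<omega>: "\<omega> \<in> space M"
    have "path_cost T x (\<lambda>t. \<xi> t \<omega>) \<kappa> (\<lambda>t. u t \<omega>) = path_cost T x r \<kappa> (\<lambda>t. u t \<omega>)"
      using assms(1) \<omega> by (intro path_cost_cong)
    then show "C \<le> path_cost T x (\<lambda>t. \<xi> t \<omega>) \<kappa> (\<lambda>t. u t \<omega>)"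
      using assms(2) admissible_control_path_measurable[OF u \<omega>] by simp
  qed
  finally show "C \<le> tracking_cost M T x \<xi> \<kappa> u"
    by (simp add: tracking_cost_eq_path_cost)
qed

end

text \<open>The finite set \<open>B\<close> is there for the jump times, at which the adjoint state
  may have a kink; continuity across \<open>B\<close> suffices.\<close>

lemma integral_indicator_derivative:
  fixes f f' :: "real \<Rightarrow> real"
  assumes "finite B" "a \<le> b" "continuous_on {a..b} f"
    and "\<And>t. t \<notin> B \<Longrightarrow> (f has_real_derivative f' t) (at t)"
    and int: "integrable lborel (\<lambda>t. indicator {a..b} t * f' t)"
  shows "(\<integral>t. indicator {a..b} t * f' t \<partial>lborel) = f b - f a"
proof -
  have "(f' has_integral (f b - f a)) {a..b}"
    using assms by (intro fundamental_theorem_of_calculus_strong[of B])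
      (auto simp: has_real_derivative_iff_has_vector_derivative)
  moreover have "set_integrable lborel {a..b} f'"
    using int by (simp add: set_integrable_def)
  ultimately show ?thesis
    using set_borel_integral_eq_integral(2)[of "{a..b}" f']
    by (simp add: set_lebesgue_integral_def integral_unique)
qed

lemma integrable_indicator_mult_continuous:
  fixes f :: "real \<Rightarrow> real"
  assumes "continuous_on UNIV f"
  shows "integrable lborel (\<lambda>t. indicator {a..b} t * f t)"
  using borel_integrable_atLeastAtMost'[of a b f] continuous_on_subset[OF assms]
  by (simp add: set_integrable_def)

section \<open>Two-sided estimate of the value around a candidate path\<close>

context usual_filtered_prob_space
begin

text \<open>\<^term>\<open>\<zeta>\<close> and \<^term>\<open>q\<close> are the deviation from \<^term>\<open>g\<close> and the adjoint state of a
  nearly optimal path. They solve the Euler-Lagrange system with source \<^term>\<open>S\<close>, except for the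
  transversality condition \<^term>\<open>q T = 0\<close>.\<close>

lemma tracking_value_estimate:
  fixes q \<zeta> g dg :: "real \<Rightarrow> real" and \<Delta> \<tau> :: "nat \<Rightarrow> real" and \<kappa> \<delta> :: real and N :: nat
  defines "S \<equiv> \<lambda>t. \<Sum>j=1..N. \<Delta> j * indicator {\<tau> j..} t"
    and "G \<equiv> \<integral>t. (dg t)\<^sup>2 \<partial>lborel"
    and "A \<equiv> q T * \<zeta> T - q 0 * \<zeta> 0 - (\<Sum>j=1..N. \<Delta> j * (q T - q (\<tau> j)))"
  assumes \<kappa>: "\<kappa> > 0" and \<delta>: "\<delta> > 0"
    and \<xi>: "\<And>t \<omega>. t \<in> {0..T} \<Longrightarrow> \<omega> \<in> space M \<Longrightarrow> \<xi> t \<omega> = \<xi>\<^sub>0 + g t + S t"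
    and dg_meas[measurable]: "dg \<in> borel_measurable borel"
    and dg_sq: "integrable lborel (\<lambda>t. (dg t)\<^sup>2)"
    and dg_supp: "\<And>t. t \<notin> {0..T} \<Longrightarrow> dg t = 0"
    and g: "\<And>t. t \<in> {0..T} \<Longrightarrow> g t = (\<integral>s. indicator {..t} s * dg s \<partial>lborel)"
    and \<tau>: "\<And>j. j \<in> {1..N} \<Longrightarrow> 0 < \<tau> j \<and> \<tau> j < T"
    and cont: "continuous_on UNIV q" "continuous_on UNIV \<zeta>"
    and q': "\<And>t. t \<notin> \<tau> ` {1..N} \<Longrightarrow> (q has_real_derivative (\<zeta> t - S t)) (at t)"
    and \<zeta>': "\<And>t. t \<notin> \<tau> ` {1..N} \<Longrightarrow> (\<zeta> has_real_derivative (q t / \<kappa>)) (at t)"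
    and \<zeta>0: "\<zeta> 0 = x - \<xi>\<^sub>0"
  shows "\<kappa>' \<ge> 0 \<Longrightarrow> tracking_value M F T x \<xi> \<kappa>' < \<infinity>"
    and "\<bar>enn2real (tracking_value M F T x \<xi> \<kappa>) - A / 2\<bar>
      \<le> 2 * \<kappa> * G + (\<delta> * G + \<kappa> * A / \<delta>) / 2 + (q T)\<^sup>2 * T / \<kappa>"
proof -
  have T: "T > 0" by (rule horizon_pos)
  define B where "B = \<tau> ` {1..N}"
  have B: "finite B" by (simp add: B_def)
  define I where "I = indicat_real {0..T}"
  have I2: "(I t)\<^sup>2 = I t" for t by (simp add: I_def indicator_def)
  have Im[measurable]: "I \<in> borel_measurable borel" by (simp add: I_def)
  have I_int: "integrable lborel I" "(\<integral>t. I t \<partial>lborel) = T"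
    unfolding I_def using T by (auto intro: integrable_indicator_Icc)
  have Sm[measurable]: "S \<in> borel_measurable borel"
    unfolding S_def by measurable
  have [measurable]: "q \<in> borel_measurable borel" "\<zeta> \<in> borel_measurable borel"
    using cont by (auto intro: borel_measurable_continuous_onI)
  \<comment> \<open>\<open>z\<close> and \<open>u\<^sub>0\<close> are the tracking error and the
    control of the candidate, \<open>p\<close> is the cut-off adjoint. The tail integral of
    \<open>z\<close> from \<open>s\<close> is \<open>q T - q s\<close>, and the part
    \<open>q s\<close> of \<open>\<kappa> * u\<^sub>0 s\<close> cancels the second term; what is
    left is \<open>e\<close>.\<close>
  define z where "z = (\<lambda>t. I t * (\<zeta> t - S t))"
  define p where "p = (\<lambda>t. I t * q t)"
  define u\<^sub>0 where "u\<^sub>0 = (\<lambda>t. dg t + p t / \<kappa>)"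
  define e where "e = (\<lambda>t. \<kappa> * dg t + q T * I t)"
  define r where "r = (\<lambda>t. \<xi>\<^sub>0 + g t + S t)"
  have zm[measurable]: "z \<in> borel_measurable borel" and pm[measurable]: "p \<in> borel_measurable borel"
    and um[measurable]: "u\<^sub>0 \<in> borel_measurable borel" and em[measurable]: "e \<in> borel_measurable borel"
    by (simp_all add: z_def p_def u\<^sub>0_def e_def)
  have S_bound: "\<bar>S t\<bar> \<le> (\<Sum>j=1..N. \<bar>\<Delta> j\<bar>)" for t
    unfolding S_def by (rule order_trans[OF sum_abs]) (auto intro!: sum_mono simp: indicator_def)
  have IS_sq: "integrable lborel (\<lambda>t. (I t * S t)\<^sup>2)"
  proof (rule Bochner_Integration.integrable_bound)
    show "integrable lborel (\<lambda>t. I t * (\<Sum>j=1..N. \<bar>\<Delta> j\<bar>)\<^sup>2)"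
      using I_int by simp
    have "(S t)\<^sup>2 \<le> (\<Sum>j=1..N. \<bar>\<Delta> j\<bar>)\<^sup>2" for t
      using S_bound[of t] by (intro abs_le_square_iff[THEN iffD1]) simp
    then show "AE t in lborel. norm ((I t * S t)\<^sup>2) \<le> norm (I t * (\<Sum>j=1..N. \<bar>\<Delta> j\<bar>)\<^sup>2)"
      by (auto simp: I_def indicator_def)
  qed measurable
  have I_sq: "integrable lborel (\<lambda>t. (I t * f t)\<^sup>2)" if "continuous_on UNIV f" for f
  proof -
    have "integrable lborel (\<lambda>t. indicator {0..T} t * (f t)\<^sup>2)"
      using that by (intro integrable_indicator_mult_continuous continuous_intros)
    moreover have "(I t * f t)\<^sup>2 = indicator {0..T} t * (f t)\<^sup>2" for t
      by (simp add: I_def indicator_def)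
    ultimately show ?thesis by simp
  qed
  have z_sq: "integrable lborel (\<lambda>t. (z t)\<^sup>2)"
  proof -
    have "integrable lborel (\<lambda>t. (1 * (I t * \<zeta> t) + (-1) * (I t * S t))\<^sup>2)"
      using IS_sq I_sq[OF cont(2)] by (intro integrable_square_lincomb) auto
    then show ?thesis by (simp add: z_def right_diff_distrib)
  qed
  have p_sq: "integrable lborel (\<lambda>t. (p t)\<^sup>2)"
    unfolding p_def by (rule I_sq[OF cont(1)])
  have u_sq: "integrable lborel (\<lambda>t. (u\<^sub>0 t)\<^sup>2)"
    using integrable_square_lincomb[OF _ _ dg_sq p_sq, of 1 "1 / \<kappa>"] by (simp add: u\<^sub>0_def)
  have e_sq: "integrable lborel (\<lambda>t. (e t)\<^sup>2)"
    unfolding e_def using dg_sq I_int by (intro integrable_square_lincomb) (auto simp: I2)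
  have supp: "z t = 0" "p t = 0" "u\<^sub>0 t = 0" if "t \<notin> {0..T}" for t
    using that dg_supp[OF that] by (auto simp: z_def p_def u\<^sub>0_def I_def indicator_def)
  have z_int: "integrable lborel z" and p_int: "integrable lborel p" and dg_int: "integrable lborel dg"
    by (rule integrable_of_square_compact_support[where a=0 and b=T]; use z_sq p_sq dg_sq supp dg_supp in simp)+
  have z_tail: "(\<integral>t. indicator {s..} t * z t \<partial>lborel) = q T - q s" if s: "s \<in> {0..T}" for s
  proof -
    have eq: "indicator {s..} t * z t = indicator {s..T} t * (\<zeta> t - S t)" for t
      using s by (auto simp: z_def I_def indicator_def)
    have "integrable lborel (\<lambda>t. indicator {s..} t * z t)"
      using integrable_mult_indicator[OF _ z_int, of "{s..}"] by simp
    then have "integrable lborel (\<lambda>t. indicator {s..T} t * (\<zeta> t - S t))"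
      by (simp add: eq)
    then have "(\<integral>t. indicator {s..T} t * (\<zeta> t - S t) \<partial>lborel) = q T - q s"
      using s q' by (intro integral_indicator_derivative[OF B]) (auto simp: B_def intro: continuous_on_subset[OF cont(1)])
    then show ?thesis by (simp add: eq)
  qed
  have p_head: "(\<integral>s. indicator {..t} s * (p s / \<kappa>) \<partial>lborel) = \<zeta> t - \<zeta> 0" if t: "t \<in> {0..T}" for t
  proof -
    have eq: "indicator {..t} s * (p s / \<kappa>) = indicator {0..t} s * (q s / \<kappa>)" for s
      using t by (auto simp: p_def I_def indicator_def)
    have "integrable lborel (\<lambda>s. indicator {0..t} s * (q s / \<kappa>))"
      using cont(1) \<kappa> by (intro integrable_indicator_mult_continuous continuous_intros) auto
    then have "(\<integral>s. indicator {0..t} s * (q s / \<kappa>) \<partial>lborel) = \<zeta> t - \<zeta> 0"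
      using t \<zeta>' by (intro integral_indicator_derivative[OF B]) (auto simp: B_def intro: continuous_on_subset[OF cont(2)])
    then show ?thesis by (simp only: eq)
  qed
  have z_state: "z t = x + (\<integral>s. indicator {..t} s * u\<^sub>0 s \<partial>lborel) - r t" if t: "t \<in> {0..T}" for t
  proof -
    have "(\<integral>s. indicator {..t} s * u\<^sub>0 s \<partial>lborel)
        = (\<integral>s. indicator {..t} s * dg s \<partial>lborel) + (\<integral>s. indicator {..t} s * (p s / \<kappa>) \<partial>lborel)"
      unfolding u\<^sub>0_def distrib_left
      using integrable_mult_indicator[OF _ dg_int, of "{..t}"] integrable_mult_indicator[OF _ p_int, of "{..t}"]
      by (intro Bochner_Integration.integral_add) auto
    then show ?thesis
      using t \<zeta>0 p_head[OF t] g[OF t] by (simp add: r_def z_def I_def)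
  qed
  have e_eq: "(\<integral>t. indicator {s..} t * z t \<partial>lborel) + \<kappa> * u\<^sub>0 s = e s" if s: "s \<in> {0..T}" for s
    unfolding z_tail[OF s] using s \<kappa> by (simp add: e_def u\<^sub>0_def p_def I_def algebra_simps)
  have \<xi>r: "\<xi> t \<omega> = r t" if "t \<in> {0..T}" "\<omega> \<in> space M" for t \<omega>
    using \<xi>[OF that] by (simp add: r_def)
  define Z where "Z = (\<integral>t. (z t)\<^sup>2 \<partial>lborel)"
  define Q where "Q = (\<integral>t. (p t)\<^sup>2 \<partial>lborel)"
  define P where "P = (\<integral>t. dg t * p t \<partial>lborel)"
  define U where "U = (\<integral>t. (u\<^sub>0 t)\<^sup>2 \<partial>lborel)"
  define E where "E = (\<integral>t. (e t)\<^sup>2 \<partial>lborel)"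
  have nonneg: "0 \<le> Z" "0 \<le> Q" "0 \<le> U" "0 \<le> G"
    unfolding Z_def Q_def U_def G_def by (intro integral_nonneg_AE; simp)+
  have cost: "path_cost T x r k u\<^sub>0 = ennreal (Z / 2 + k / 2 * U)" if "k \<ge> 0" for k
    unfolding Z_def U_def by (rule path_cost_eq[OF that z_sq u_sq supp(1,3) z_state])
  have upper: "tracking_value M F T x \<xi> k \<le> ennreal (Z / 2 + k / 2 * U)" if "k \<ge> 0" for k
    unfolding cost[OF that, symmetric]
    by (rule tracking_value_le[where \<xi>=\<xi> and r=r, OF \<xi>r um u_sq])
  show fin: "tracking_value M F T x \<xi> \<kappa>' < \<infinity>" if "\<kappa>' \<ge> 0" for \<kappa>'
    using upper[OF that] by (rule le_less_trans) simp
  have lower: "ennreal (Z / 2 + \<kappa> / 2 * U - E / (2 * \<kappa>)) \<le> tracking_value M F T x \<xi> \<kappa>"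
    unfolding Z_def U_def E_def
    by (rule tracking_value_ge[where r=r], erule (1) \<xi>r,
        rule path_cost_ge[OF \<kappa> zm um em z_sq u_sq e_sq supp(1,3) e_eq z_state])
  define V where "V = enn2real (tracking_value M F T x \<xi> \<kappa>)"
  have V: "tracking_value M F T x \<xi> \<kappa> = ennreal V" "V \<ge> 0"
    using fin[of \<kappa>] \<kappa> by (auto simp: V_def)
  have V_le: "V \<le> Z / 2 + \<kappa> / 2 * U"
    using upper[of \<kappa>] \<kappa> nonneg V by (simp del: ennreal_plus)
  have V_ge: "Z / 2 + \<kappa> / 2 * U - E / (2 * \<kappa>) \<le> V"
    using lower V by simp
  have dgp: "integrable lborel (\<lambda>t. dg t * p t)"
    using dg_sq p_sq by (intro integrable_mult_of_squares) auto
  \<comment> \<open>\<open>P\<close> is the only coupling between the smooth part \<open>g\<close>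
    and the layers.\<close>
  have U_eq: "\<kappa> / 2 * U = \<kappa> / 2 * G + P + Q / \<kappa> / 2"
  proof -
    have "U = (\<integral>t. (dg t)\<^sup>2 + 2 / \<kappa> * (dg t * p t) + (p t)\<^sup>2 / \<kappa>\<^sup>2 \<partial>lborel)"
      unfolding U_def u\<^sub>0_def by (intro Bochner_Integration.integral_cong) (auto simp: power2_sum power_divide)
    also have "\<dots> = G + 2 / \<kappa> * P + Q / \<kappa>\<^sup>2"
      unfolding G_def P_def Q_def using dg_sq dgp p_sq by simp
    finally show ?thesis using \<kappa> by (simp add: field_simps power2_eq_square)
  qed
  \<comment> \<open>Since \<open>\<zeta>\<close> is \<open>z + S\<close> on the interval,
    integrating the derivative of \<open>q * \<zeta>\<close> yields the two squares plus the
    integral of \<open>z * S\<close>. The latter is a combination of tail integrals of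
    \<open>z\<close> from the jump times, known from \<open>z_tail\<close>.\<close>
  have A_eq: "Z + Q / \<kappa> = A"
  proof -
    have zI: "z t * (I t * c) = z t * c" for t c
      by (simp add: z_def I_def indicator_def)
    have zS_int: "integrable lborel (\<lambda>t. z t * S t)"
      using integrable_mult_of_squares[OF _ _ z_sq IS_sq] by (simp add: zI)
    have ev: "indicator {0..T} t * ((\<zeta> t - S t) * \<zeta> t + q t / \<kappa> * q t)
        = (z t)\<^sup>2 + z t * S t + (p t)\<^sup>2 / \<kappa>" for t
      by (simp add: z_def p_def I_def indicator_def power2_eq_square algebra_simps)
    have int: "integrable lborel (\<lambda>t. (z t)\<^sup>2 + z t * S t + (p t)\<^sup>2 / \<kappa>)"
      using z_sq zS_int p_sq by simp
    have "(\<integral>t. indicator {0..T} t * ((\<zeta> t - S t) * \<zeta> t + q t / \<kappa> * q t) \<partial>lborel) = q T * \<zeta> T - q 0 * \<zeta> 0"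
    proof (rule integral_indicator_derivative[OF B])
      show "continuous_on {0..T} (\<lambda>t. q t * \<zeta> t)"
        by (rule continuous_on_subset[of UNIV]) (intro continuous_intros cont, simp)
      show "((\<lambda>t. q t * \<zeta> t) has_real_derivative (\<zeta> t - S t) * \<zeta> t + q t / \<kappa> * q t) (at t)" if "t \<notin> B" for t
        by (rule DERIV_mult) (use that q' \<zeta>' in \<open>auto simp: B_def\<close>)
    qed (use T int ev in simp_all)
    then have "Z + (\<integral>t. z t * S t \<partial>lborel) + Q / \<kappa> = q T * \<zeta> T - q 0 * \<zeta> 0"
      unfolding ev Z_def Q_def using z_sq zS_int p_sq by simp
    moreover have "(\<integral>t. z t * S t \<partial>lborel) = (\<Sum>j=1..N. \<Delta> j * (q T - q (\<tau> j)))"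
    proof -
      have "(\<integral>t. z t * S t \<partial>lborel) = (\<integral>t. (\<Sum>j=1..N. \<Delta> j * (indicator {\<tau> j..} t * z t)) \<partial>lborel)"
        unfolding S_def sum_distrib_left by (intro Bochner_Integration.integral_cong sum.cong) auto
      also have "\<dots> = (\<Sum>j=1..N. \<Delta> j * (\<integral>t. indicator {\<tau> j..} t * z t \<partial>lborel))"
        using integrable_mult_indicator[OF _ z_int] by (subst Bochner_Integration.integral_sum) auto
      also have "\<dots> = (\<Sum>j=1..N. \<Delta> j * (q T - q (\<tau> j)))"
        using \<tau> by (intro sum.cong refl arg_cong2[where f="(*)"] z_tail) (auto intro: less_imp_le)
      finally show ?thesis .
    qed
    ultimately show ?thesis by (simp add: A_def)
  qed
  \<comment> \<open>Young's inequality with the free weight \<open>\<delta>\<close>. The energy of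
    \<open>p\<close> is at most \<open>\<kappa> * A\<close>, because \<open>Z\<close> is nonnegative
    in \<open>A_eq\<close>.\<close>
  have P_le: "\<bar>P\<bar> \<le> (\<delta> * G + \<kappa> * A / \<delta>) / 2"
  proof -
    have "\<bar>a * b\<bar> \<le> (\<delta> * a\<^sup>2 + b\<^sup>2 / \<delta>) / 2" for a b
    proof -
      have "0 \<le> (\<delta> * \<bar>a\<bar> - \<bar>b\<bar>)\<^sup>2 / \<delta>" using \<delta> by simp
      also have "\<dots> = \<delta> * a\<^sup>2 + b\<^sup>2 / \<delta> - 2 * \<bar>a * b\<bar>"
        using \<delta> by (simp add: power2_diff power_mult_distrib field_simps abs_mult power2_eq_square)
      finally show ?thesis by simp
    qed
    then have "(\<integral>t. \<bar>dg t * p t\<bar> \<partial>lborel) \<le> (\<integral>t. (\<delta> * (dg t)\<^sup>2 + (p t)\<^sup>2 / \<delta>) / 2 \<partial>lborel)"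
      using dgp dg_sq p_sq by (intro integral_mono) auto
    also have "\<dots> = (\<delta> * G + Q / \<delta>) / 2"
      unfolding G_def Q_def using dg_sq p_sq by simp
    finally have "\<bar>P\<bar> \<le> (\<delta> * G + Q / \<delta>) / 2"
      unfolding P_def by (rule order_trans[OF integral_abs_bound])
    moreover have "Q \<le> \<kappa> * A"
      using A_eq nonneg \<kappa> by (simp add: field_simps flip: A_eq)
    ultimately show ?thesis
      using \<delta> divide_right_mono[of Q "\<kappa> * A" \<delta>] by simp
  qed
  \<comment> \<open>The two parts of the residual are separated: \<open>\<kappa> * dg\<close>
    contributes only a multiple of \<open>\<kappa>\<close>, and \<open>q T\<close> measures the
    failure of transversality.\<close>
  have E_le: "E / (2 * \<kappa>) \<le> \<kappa> * G + (q T)\<^sup>2 * T / \<kappa>"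
  proof -
    have "(a + b)\<^sup>2 \<le> 2 * a\<^sup>2 + 2 * b\<^sup>2" for a b :: real
      using sum_squares_bound[of a b] by (simp add: power2_sum)
    then have "(e t)\<^sup>2 \<le> 2 * \<kappa>\<^sup>2 * (dg t)\<^sup>2 + 2 * (q T)\<^sup>2 * I t" for t
      unfolding e_def by (rule order_trans) (simp add: power_mult_distrib I2)
    then have "E \<le> (\<integral>t. 2 * \<kappa>\<^sup>2 * (dg t)\<^sup>2 + 2 * (q T)\<^sup>2 * I t \<partial>lborel)"
      unfolding E_def using e_sq dg_sq I_int by (intro integral_mono) auto
    also have "\<dots> = 2 * \<kappa>\<^sup>2 * G + 2 * (q T)\<^sup>2 * T"
      unfolding G_def using dg_sq I_int by simp
    finally show ?thesis using \<kappa> by (simp add: field_simps power2_eq_square)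
  qed
  have "Z / 2 + \<kappa> / 2 * U = A / 2 + \<kappa> / 2 * G + P"
    unfolding U_eq A_eq[symmetric] by (simp add: add_divide_distrib)
  moreover have "0 \<le> \<kappa> * G" "0 \<le> (q T)\<^sup>2 * T / \<kappa>"
    using nonneg \<kappa> T by simp_all
  moreover have "\<kappa> / 2 * G = \<kappa> * G / 2" "2 * \<kappa> * G = 2 * (\<kappa> * G)"
    by simp_all
  ultimately have "\<bar>V - A / 2\<bar> \<le> 2 * \<kappa> * G + (\<delta> * G + \<kappa> * A / \<delta>) / 2 + (q T)\<^sup>2 * T / \<kappa>"
    using V_le V_ge E_le P_le abs_ge_self[of P] abs_ge_minus_self[of P] by (intro abs_leI) linarith+
  then show "\<bar>enn2real (tracking_value M F T x \<xi> \<kappa>) - A / 2\<bar>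
      \<le> 2 * \<kappa> * G + (\<delta> * G + \<kappa> * A / \<delta>) / 2 + (q T)\<^sup>2 * T / \<kappa>"
    by (simp add: V_def)
qed

end

section \<open>Boundary and interior layers\<close>

definition peak :: "real \<Rightarrow> real \<Rightarrow> real \<Rightarrow> real" where
  "peak \<epsilon> s t = exp (- \<bar>t - s\<bar> / \<epsilon>)"

text \<open>A rise from 0 to 2 centred at \<open>s\<close>, which is why each jump later carries a
  factor \<open>1/2\<close>. The \<open>min\<close> and \<open>max\<close> merge two exponential
  branches into one visibly continuous formula.\<close>

definition front :: "real \<Rightarrow> real \<Rightarrow> real \<Rightarrow> real" where
  "front \<epsilon> s t = exp ((min s t - s) / \<epsilon>) + 1 - exp ((s - max s t) / \<epsilon>)"

lemma continuous_on_peak: "continuous_on A (peak \<epsilon> s)"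
  unfolding peak_def by (cases "\<epsilon> = 0") (auto intro!: continuous_intros)

lemma continuous_on_front: "continuous_on A (front \<epsilon> s)"
  unfolding front_def by (cases "\<epsilon> = 0") (auto intro!: continuous_intros)

text \<open>Removing the full jump leaves a profile that decays on both sides of \<open>s\<close>
  and, off \<open>s\<close>, is \<open>\<epsilon>\<close> times the derivative of
  \<open>peak\<close>. Thus \<open>peak\<close> and \<open>front\<close> solve the first-order
  system with a single jump as source.\<close>

lemma front_minus_jump: "front \<epsilon> s t - 2 * indicator {s..} t = (if t < s then peak \<epsilon> s t else - peak \<epsilon> s t)"
  by (simp add: front_def peak_def indicator_def min_def max_def)

lemma peak_has_derivative:
  assumes "\<epsilon> \<noteq> 0" "t \<noteq> s"
  shows "(peak \<epsilon> s has_real_derivative ((front \<epsilon> s t - 2 * indicator {s..} t) / \<epsilon>)) (at t)"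
proof (cases "t < s")
  case True
  have "((\<lambda>t. exp ((t - s) / \<epsilon>)) has_real_derivative peak \<epsilon> s t / \<epsilon>) (at t)"
    unfolding peak_def using True assms by (auto intro!: derivative_eq_intros)
  then show ?thesis
    unfolding front_minus_jump using True
    by (auto simp: peak_def intro: has_field_derivative_transform_within_open[of _ _ _ "{..<s}"])
next
  case False
  with assms have "s < t" by simp
  have "((\<lambda>t. exp ((s - t) / \<epsilon>)) has_real_derivative - peak \<epsilon> s t / \<epsilon>) (at t)"
    unfolding peak_def using \<open>s < t\<close> assms by (auto intro!: derivative_eq_intros)
  then show ?thesis
    unfolding front_minus_jump using \<open>s < t\<close>
    by (auto simp: peak_def intro: has_field_derivative_transform_within_open[of _ _ _ "{s<..}"])
qed

lemma front_has_derivative: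
  assumes "\<epsilon> \<noteq> 0" "t \<noteq> s"
  shows "(front \<epsilon> s has_real_derivative (peak \<epsilon> s t / \<epsilon>)) (at t)"
proof (cases "t < s")
  case True
  have "((\<lambda>t. exp ((t - s) / \<epsilon>)) has_real_derivative peak \<epsilon> s t / \<epsilon>) (at t)"
    unfolding peak_def using True assms by (auto intro!: derivative_eq_intros)
  then show ?thesis
    using True by (auto simp: front_def intro: has_field_derivative_transform_within_open[of _ _ _ "{..<s}"])
next
  case False
  with assms have "s < t" by simp
  have "((\<lambda>t. 2 - exp ((s - t) / \<epsilon>)) has_real_derivative peak \<epsilon> s t / \<epsilon>) (at t)"
    unfolding peak_def using \<open>s < t\<close> assms by (auto intro!: derivative_eq_intros)
  then show ?thesis
    using \<open>s < t\<close> by (auto simp: front_def intro: has_field_derivative_transform_within_open[of _ _ _ "{s<..}"])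
qed

lemma exp_decay_sqrt: "((\<lambda>\<epsilon>. exp (- c / \<epsilon>) / sqrt \<epsilon>) \<longlongrightarrow> 0) (at_right (0::real))" if "c > 0"
  using that by real_asymp

lemma exp_decay: "((\<lambda>\<epsilon>. exp (- c / \<epsilon>)) \<longlongrightarrow> 0) (at_right (0::real))" if "c > 0"
  using that by real_asymp

section \<open>Superposition of the layers and its limits for vanishing width\<close>

locale jump_layers =
  fixes y T :: real and N :: nat and \<Delta> \<tau> :: "nat \<Rightarrow> real"
  assumes T_pos: "0 < T"
    and jump_times: "\<And>j. j \<in> {1..N} \<Longrightarrow> 0 < \<tau> j \<and> \<tau> j < T"
    and inj_jump_times: "inj_on \<tau> {1..N}"
begin

text \<open>The amplitude of the initial layer is chosen to compensate the tails of the inner layers at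
  time \<open>0\<close>, so that \<open>layer_state \<epsilon> 0 = y\<close> holds exactly.\<close>

definition amplitude :: "real \<Rightarrow> real" where
  "amplitude \<epsilon> = y - (\<Sum>j=1..N. \<Delta> j / 2 * exp (- \<tau> j / \<epsilon>))"

definition layer_state :: "real \<Rightarrow> real \<Rightarrow> real" where
  "layer_state \<epsilon> t = amplitude \<epsilon> * exp (- t / \<epsilon>) + (\<Sum>j=1..N. \<Delta> j / 2 * front \<epsilon> (\<tau> j) t)"

text \<open>This is \<open>\<epsilon>\<^sup>2\<close> times the derivative of
  \<open>layer_state\<close>, hence the minus sign at the decaying initial layer.\<close>

definition layer_adjoint :: "real \<Rightarrow> real \<Rightarrow> real" where
  "layer_adjoint \<epsilon> t = \<epsilon> * ((\<Sum>j=1..N. \<Delta> j / 2 * peak \<epsilon> (\<tau> j) t) - amplitude \<epsilon> * exp (- t / \<epsilon>))"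

text \<open>The quantity \<open>A\<close> of \<open>tracking_value_estimate\<close> for these
  layers: their energy, reduced to values at \<open>0\<close>, \<open>T\<close> and the jump
  times.\<close>

definition layer_energy :: "real \<Rightarrow> real" where
  "layer_energy \<epsilon> = layer_adjoint \<epsilon> T * layer_state \<epsilon> T - layer_adjoint \<epsilon> 0 * layer_state \<epsilon> 0
    - (\<Sum>j=1..N. \<Delta> j * (layer_adjoint \<epsilon> T - layer_adjoint \<epsilon> (\<tau> j)))"

lemma continuous_on_layers:
  assumes "\<epsilon> > 0"
  shows "continuous_on A (layer_adjoint \<epsilon>)" "continuous_on A (layer_state \<epsilon>)"
  unfolding layer_adjoint_def layer_state_def using assms
  by (auto intro!: continuous_intros continuous_on_peak continuous_on_front)

lemma layer_state_0: "layer_state \<epsilon> 0 = y"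
proof -
  have "front \<epsilon> (\<tau> j) 0 = exp (- \<tau> j / \<epsilon>)" if "j \<in> {1..N}" for j
    using jump_times[OF that] by (simp add: front_def)
  then show ?thesis by (simp add: layer_state_def amplitude_def)
qed

lemma layer_state_has_derivative:
  assumes "\<epsilon> > 0" "t \<notin> \<tau> ` {1..N}"
  shows "(layer_state \<epsilon> has_real_derivative (layer_adjoint \<epsilon> t / \<epsilon>\<^sup>2)) (at t)"
proof -
  have "((\<lambda>t. \<Sum>j=1..N. \<Delta> j / 2 * front \<epsilon> (\<tau> j) t) has_real_derivative
      (\<Sum>j=1..N. \<Delta> j / 2 * (peak \<epsilon> (\<tau> j) t / \<epsilon>))) (at t)"
    using assms by (intro DERIV_sum DERIV_cmult front_has_derivative) auto
  moreover have "((\<lambda>t. amplitude \<epsilon> * exp (- t / \<epsilon>)) has_real_derivative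
      - amplitude \<epsilon> * exp (- t / \<epsilon>) / \<epsilon>) (at t)"
    using assms by (auto intro!: derivative_eq_intros)
  ultimately have "(layer_state \<epsilon> has_real_derivative - amplitude \<epsilon> * exp (- t / \<epsilon>) / \<epsilon>
      + (\<Sum>j=1..N. \<Delta> j / 2 * (peak \<epsilon> (\<tau> j) t / \<epsilon>))) (at t)"
    unfolding layer_state_def by (intro DERIV_add)
  also have "- amplitude \<epsilon> * exp (- t / \<epsilon>) / \<epsilon> + (\<Sum>j=1..N. \<Delta> j / 2 * (peak \<epsilon> (\<tau> j) t / \<epsilon>))
      = layer_adjoint \<epsilon> t / \<epsilon>\<^sup>2"
    using assms by (simp add: layer_adjoint_def power2_eq_square diff_divide_distrib flip: sum_divide_distrib)
  finally show ?thesis .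
qed

lemma layer_adjoint_has_derivative:
  assumes "\<epsilon> > 0" "t \<notin> \<tau> ` {1..N}"
  shows "(layer_adjoint \<epsilon> has_real_derivative
    (layer_state \<epsilon> t - (\<Sum>j=1..N. \<Delta> j * indicator {\<tau> j..} t))) (at t)"
proof -
  have "((\<lambda>t. \<Sum>j=1..N. \<Delta> j / 2 * peak \<epsilon> (\<tau> j) t) has_real_derivative
      (\<Sum>j=1..N. \<Delta> j / 2 * ((front \<epsilon> (\<tau> j) t - 2 * indicator {\<tau> j..} t) / \<epsilon>))) (at t)"
    using assms by (intro DERIV_sum DERIV_cmult peak_has_derivative) auto
  moreover have "((\<lambda>t. amplitude \<epsilon> * exp (- t / \<epsilon>)) has_real_derivative
      - amplitude \<epsilon> * exp (- t / \<epsilon>) / \<epsilon>) (at t)"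
    using assms by (auto intro!: derivative_eq_intros)
  ultimately have "(layer_adjoint \<epsilon> has_real_derivative \<epsilon> *
      ((\<Sum>j=1..N. \<Delta> j / 2 * ((front \<epsilon> (\<tau> j) t - 2 * indicator {\<tau> j..} t) / \<epsilon>))
        - (- amplitude \<epsilon> * exp (- t / \<epsilon>) / \<epsilon>))) (at t)"
    unfolding layer_adjoint_def by (intro DERIV_cmult DERIV_diff)
  also have "\<epsilon> * ((\<Sum>j=1..N. \<Delta> j / 2 * ((front \<epsilon> (\<tau> j) t - 2 * indicator {\<tau> j..} t) / \<epsilon>))
        - (- amplitude \<epsilon> * exp (- t / \<epsilon>) / \<epsilon>))
      = (\<Sum>j=1..N. \<Delta> j / 2 * (front \<epsilon> (\<tau> j) t - 2 * indicator {\<tau> j..} t)) + amplitude \<epsilon> * exp (- t / \<epsilon>)"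
  proof -
    have "(\<Sum>j=1..N. \<Delta> j / 2 * ((front \<epsilon> (\<tau> j) t - 2 * indicator {\<tau> j..} t) / \<epsilon>))
        = (\<Sum>j=1..N. \<Delta> j / 2 * (front \<epsilon> (\<tau> j) t - 2 * indicator {\<tau> j..} t)) / \<epsilon>"
      unfolding sum_divide_distrib by simp
    then show ?thesis
      using assms(1) by (simp add: distrib_left del: sum_divide_distrib)
  qed
  also have "\<dots> = layer_state \<epsilon> t - (\<Sum>j=1..N. \<Delta> j * indicator {\<tau> j..} t)"
    by (simp add: layer_state_def right_diff_distrib sum_subtractf)
  finally show ?thesis .
qed

lemma amplitude_tendsto: "(amplitude \<longlongrightarrow> y) (at_right 0)"
proof -
  have "((\<lambda>\<epsilon>. y - (\<Sum>j=1..N. \<Delta> j / 2 * exp (- \<tau> j / \<epsilon>))) \<longlongrightarrow> y - (\<Sum>j=1..N. \<Delta> j / 2 * 0)) (at_right 0)"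
    using jump_times by (intro tendsto_intros exp_decay) auto
  then show ?thesis by (simp add: amplitude_def[abs_def])
qed

text \<open>The transversality defect is exponentially small because \<open>0\<close> and all jump
  times lie strictly before \<open>T\<close>. The divisor squares to the cube of
  \<open>\<epsilon>\<close>, which is what \<open>(q T)\<^sup>2 * T / \<kappa>\<close> requires for
  \<open>\<kappa> = \<epsilon>\<^sup>2\<close> after division by \<open>\<epsilon>\<close>.\<close>

lemma layer_adjoint_T_tendsto:
  "((\<lambda>\<epsilon>. layer_adjoint \<epsilon> T / (\<epsilon> * sqrt \<epsilon>)) \<longlongrightarrow> 0) (at_right 0)"
proof -
  have "((\<lambda>\<epsilon>. (\<Sum>j=1..N. \<Delta> j / 2 * (exp (- (T - \<tau> j) / \<epsilon>) / sqrt \<epsilon>)) - amplitude \<epsilon> * (exp (- T / \<epsilon>) / sqrt \<epsilon>))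
      \<longlongrightarrow> (\<Sum>j=1..N. \<Delta> j / 2 * 0) - y * 0) (at_right 0)"
    using jump_times T_pos by (intro tendsto_intros exp_decay_sqrt amplitude_tendsto) auto
  moreover have "eventually (\<lambda>\<epsilon>. (\<Sum>j=1..N. \<Delta> j / 2 * (exp (- (T - \<tau> j) / \<epsilon>) / sqrt \<epsilon>))
      - amplitude \<epsilon> * (exp (- T / \<epsilon>) / sqrt \<epsilon>) = layer_adjoint \<epsilon> T / (\<epsilon> * sqrt \<epsilon>)) (at_right 0)"
  proof (rule eventually_at_right_less[THEN eventually_mono])
    fix \<epsilon> :: real assume \<epsilon>: "0 < \<epsilon>"
    have "exp (- (T - \<tau> j) / \<epsilon>) = peak \<epsilon> (\<tau> j) T" if "j \<in> {1..N}" for j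
      using jump_times[OF that] by (simp add: peak_def)
    then have "(\<Sum>j=1..N. \<Delta> j / 2 * (exp (- (T - \<tau> j) / \<epsilon>) / sqrt \<epsilon>)) = (\<Sum>j=1..N. \<Delta> j / 2 * peak \<epsilon> (\<tau> j) T) / sqrt \<epsilon>"
      unfolding sum_divide_distrib by (intro sum.cong) auto
    then show "(\<Sum>j=1..N. \<Delta> j / 2 * (exp (- (T - \<tau> j) / \<epsilon>) / sqrt \<epsilon>))
      - amplitude \<epsilon> * (exp (- T / \<epsilon>) / sqrt \<epsilon>) = layer_adjoint \<epsilon> T / (\<epsilon> * sqrt \<epsilon>)"
      using \<epsilon> by (simp add: layer_adjoint_def diff_divide_distrib)
  qed
  ultimately show ?thesis
    by (simp add: Lim_transform_eventually)
qed

text \<open>Applied at \<open>T\<close>, at \<open>0\<close> and at the jump times; there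
  \<open>c j\<close> and \<open>d\<close> are 0 or 1 according to whether the layer is centred at
  \<open>t\<close>.\<close>

lemma layer_adjoint_tendsto:
  assumes "\<And>j. j \<in> {1..N} \<Longrightarrow> ((\<lambda>\<epsilon>. peak \<epsilon> (\<tau> j) t) \<longlongrightarrow> c j) (at_right 0)"
    and "((\<lambda>\<epsilon>. exp (- t / \<epsilon>)) \<longlongrightarrow> d) (at_right 0)"
  shows "((\<lambda>\<epsilon>. layer_adjoint \<epsilon> t / \<epsilon>) \<longlongrightarrow> (\<Sum>j=1..N. \<Delta> j / 2 * c j) - y * d) (at_right 0)"
proof -
  have "((\<lambda>\<epsilon>. (\<Sum>j=1..N. \<Delta> j / 2 * peak \<epsilon> (\<tau> j) t) - amplitude \<epsilon> * exp (- t / \<epsilon>))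
      \<longlongrightarrow> (\<Sum>j=1..N. \<Delta> j / 2 * c j) - y * d) (at_right 0)"
    using assms by (intro tendsto_intros amplitude_tendsto) auto
  moreover have "eventually (\<lambda>\<epsilon>. (\<Sum>j=1..N. \<Delta> j / 2 * peak \<epsilon> (\<tau> j) t) - amplitude \<epsilon> * exp (- t / \<epsilon>)
      = layer_adjoint \<epsilon> t / \<epsilon>) (at_right 0)"
    by (rule eventually_at_right_less[THEN eventually_mono]) (simp add: layer_adjoint_def)
  ultimately show ?thesis
    by (rule Lim_transform_eventually)
qed

lemma peak_tendsto:
  assumes "t \<noteq> s"
  shows "((\<lambda>\<epsilon>. peak \<epsilon> s t) \<longlongrightarrow> 0) (at_right 0)"
  unfolding peak_def using assms by (intro exp_decay) auto

text \<open>Divided by \<open>\<epsilon>\<close>, the adjoint tends to 0 at \<open>T\<close>, to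
  \<open>- y\<close> at \<open>0\<close> and to \<open>\<Delta> i / 2\<close> at
  \<open>\<tau> i\<close>. A jump is anticipated and so split evenly between both sides of its time,
  while the initial gap closes on one side only; this halves the jump coefficient.\<close>

lemma layer_energy_tendsto:
  "((\<lambda>\<epsilon>. layer_energy \<epsilon> / \<epsilon>) \<longlongrightarrow> y\<^sup>2 + (\<Sum>j=1..N. (\<Delta> j)\<^sup>2) / 2) (at_right 0)"
proof -
  have adj_T: "((\<lambda>\<epsilon>. layer_adjoint \<epsilon> T / \<epsilon>) \<longlongrightarrow> 0) (at_right 0)"
    using layer_adjoint_tendsto[OF peak_tendsto exp_decay, of T] jump_times T_pos by fastforce
  have adj_0: "((\<lambda>\<epsilon>. layer_adjoint \<epsilon> 0 / \<epsilon>) \<longlongrightarrow> - y) (at_right 0)"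
    using layer_adjoint_tendsto[OF peak_tendsto, of 0 1] jump_times by fastforce
  have adj_\<tau>: "((\<lambda>\<epsilon>. layer_adjoint \<epsilon> (\<tau> i) / \<epsilon>) \<longlongrightarrow> \<Delta> i / 2) (at_right 0)" if i: "i \<in> {1..N}" for i
  proof -
    \<comment> \<open>Distinctness of the jump times enters here: seen from \<open>\<tau> i\<close>,
      every other layer vanishes in the limit.\<close>
    have "((\<lambda>\<epsilon>. peak \<epsilon> (\<tau> j) (\<tau> i)) \<longlongrightarrow> (if j = i then 1 else 0)) (at_right 0)" if j: "j \<in> {1..N}" for j
    proof (cases "j = i")
      case True
      then show ?thesis by (simp add: peak_def)
    next
      case False
      then have "\<tau> i \<noteq> \<tau> j" using inj_jump_times i j by (auto dest: inj_onD)
      with False show ?thesis by (simp add: peak_tendsto)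
    qed
    then have "((\<lambda>\<epsilon>. layer_adjoint \<epsilon> (\<tau> i) / \<epsilon>) \<longlongrightarrow>
        (\<Sum>j=1..N. \<Delta> j / 2 * (if j = i then 1 else 0)) - y * 0) (at_right 0)"
      using jump_times[OF i] by (intro layer_adjoint_tendsto exp_decay) auto
    moreover have "(\<Sum>j=1..N. \<Delta> j / 2 * (if j = i then 1 else 0)) = \<Delta> i / 2"
      using i by (simp add: if_distrib sum.delta cong: if_cong)
    ultimately show ?thesis by (simp only: mult_zero_right diff_0_right)
  qed
  \<comment> \<open>Any finite limit would do, as this factor multiplies the vanishing
    \<open>layer_adjoint \<epsilon> T / \<epsilon>\<close>.\<close>
  have state_T: "((\<lambda>\<epsilon>. layer_state \<epsilon> T) \<longlongrightarrow> (\<Sum>j=1..N. \<Delta> j)) (at_right 0)"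
  proof -
    have front: "front \<epsilon> (\<tau> j) T = 2 - peak \<epsilon> (\<tau> j) T" if "j \<in> {1..N}" for j \<epsilon>
      using front_minus_jump[of \<epsilon> "\<tau> j" T] jump_times[OF that] by simp
    have "((\<lambda>\<epsilon>. amplitude \<epsilon> * exp (- T / \<epsilon>) + (\<Sum>j=1..N. \<Delta> j / 2 * (2 - peak \<epsilon> (\<tau> j) T)))
        \<longlongrightarrow> y * 0 + (\<Sum>j=1..N. \<Delta> j / 2 * (2 - 0))) (at_right 0)"
      using jump_times T_pos by (intro tendsto_intros amplitude_tendsto exp_decay peak_tendsto) force+
    then show ?thesis by (simp add: layer_state_def front)
  qed
  have "((\<lambda>\<epsilon>. layer_adjoint \<epsilon> T / \<epsilon> * layer_state \<epsilon> T - layer_adjoint \<epsilon> 0 / \<epsilon> * y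
      - (\<Sum>j=1..N. \<Delta> j * (layer_adjoint \<epsilon> T / \<epsilon> - layer_adjoint \<epsilon> (\<tau> j) / \<epsilon>)))
      \<longlongrightarrow> 0 * (\<Sum>j=1..N. \<Delta> j) - (- y) * y - (\<Sum>j=1..N. \<Delta> j * (0 - \<Delta> j / 2))) (at_right 0)"
    by (intro tendsto_intros adj_T adj_0 adj_\<tau> state_T) auto
  moreover have "0 * (\<Sum>j=1..N. \<Delta> j) - (- y) * y - (\<Sum>j=1..N. \<Delta> j * (0 - \<Delta> j / 2))
      = y\<^sup>2 + (\<Sum>j=1..N. (\<Delta> j)\<^sup>2) / 2"
    by (simp add: power2_eq_square sum_negf sum_divide_distrib)
  moreover have "layer_adjoint \<epsilon> T / \<epsilon> * layer_state \<epsilon> T - layer_adjoint \<epsilon> 0 / \<epsilon> * y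
      - (\<Sum>j=1..N. \<Delta> j * (layer_adjoint \<epsilon> T / \<epsilon> - layer_adjoint \<epsilon> (\<tau> j) / \<epsilon>)) = layer_energy \<epsilon> / \<epsilon>" for \<epsilon>
    by (simp add: layer_energy_def layer_state_0 diff_divide_distrib sum_divide_distrib right_diff_distrib)
  ultimately show ?thesis by simp
qed

end

section \<open>The expansion of the value, obtained in the layer width and transferred to the
  weight\<close>

theorem proposition2p8:
  fixes M :: "'a measure" and F :: "real \<Rightarrow> 'a measure" and T x \<xi>\<^sub>0 :: real
    and \<xi> :: "real \<Rightarrow> 'a \<Rightarrow> real" and g :: "real \<Rightarrow> real"
    and N :: nat and \<Delta> \<tau> :: "nat \<Rightarrow> real"
  defines "v \<equiv> tracking_value M F T x \<xi>"
  assumes "usual_filtered_prob_space M F T"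
    and "g \<in> sobolev_H1 0 T" and "g 0 = 0"
    and "\<And>j. j \<in> {1..N} \<Longrightarrow> 0 < \<tau> j \<and> \<tau> j < T"
    and "strict_mono_on {1..N} \<tau>"
    and "\<And>t \<omega>. t \<in> {0..T} \<Longrightarrow> \<omega> \<in> space M \<Longrightarrow>
           \<xi> t \<omega> = \<xi>\<^sub>0 + g t + (\<Sum>j=1..N. \<Delta> j * indicator {\<tau> j..} t)"
  shows "(\<forall>\<kappa>\<ge>0. v \<kappa> < \<infinity>) \<and>
    (\<lambda>\<kappa>. enn2real (v \<kappa>)
        - sqrt \<kappa> * (1/2 * (x - \<xi>\<^sub>0)\<^sup>2 + 1/4 * (\<Sum>j=1..N. (\<Delta> j)\<^sup>2)))
      \<in> o[at_right 0](\<lambda>\<kappa>. sqrt \<kappa>) \<and>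
    (x \<noteq> \<xi>\<^sub>0 \<or> (\<exists>j\<in>{1..N}. \<Delta> j \<noteq> 0) \<longrightarrow>
      (\<lambda>\<kappa>. enn2real (v \<kappa>)) \<in> \<Theta>[at_right 0](\<lambda>\<kappa>. sqrt \<kappa>))"
proof -
  interpret usual_filtered_prob_space M F T by fact
  interpret jump_layers "x - \<xi>\<^sub>0" T N \<Delta> \<tau>
    using horizon_pos assms(5) strict_mono_on_imp_inj_on[OF assms(6)] by unfold_locales auto
  obtain dg where dg: "dg \<in> borel_measurable borel" "integrable lborel (\<lambda>t. (dg t)\<^sup>2)"
    "\<And>t. t \<notin> {0..T} \<Longrightarrow> dg t = 0"
    "\<And>t. t \<in> {0..T} \<Longrightarrow> g t = (\<integral>s. indicator {..t} s * dg s \<partial>lborel)"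
    using sobolev_H1_primitive[OF assms(3,4)] by blast
  define G where "G = (\<integral>t. (dg t)\<^sup>2 \<partial>lborel)"
  define C where "C = 1/2 * (x - \<xi>\<^sub>0)\<^sup>2 + 1/4 * (\<Sum>j=1..N. (\<Delta> j)\<^sup>2)"
  \<comment> \<open>Instance \<open>\<kappa> = \<epsilon>\<^sup>2\<close>,
    \<open>\<delta> = \<epsilon> * sqrt \<epsilon>\<close>. As the layer energy is of order
    \<open>\<epsilon>\<close>, this weight makes both terms \<open>\<delta> * G\<close> and
    \<open>\<kappa> * A / \<delta>\<close> of order
    \<open>\<epsilon> * sqrt \<epsilon>\<close>.\<close>
  have est: "(\<kappa>' \<ge> 0 \<longrightarrow> v \<kappa>' < \<infinity>) \<and> \<bar>enn2real (v (\<epsilon>\<^sup>2)) - layer_energy \<epsilon> / 2\<bar>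
      \<le> 2 * \<epsilon>\<^sup>2 * G + (\<epsilon> * sqrt \<epsilon> * G + \<epsilon>\<^sup>2 * layer_energy \<epsilon> / (\<epsilon> * sqrt \<epsilon>)) / 2 + (layer_adjoint \<epsilon> T)\<^sup>2 * T / \<epsilon>\<^sup>2"
    if \<epsilon>: "\<epsilon> > 0" for \<epsilon> \<kappa>'
  proof -
    have pos: "\<epsilon>\<^sup>2 > 0" "\<epsilon> * sqrt \<epsilon> > 0" using \<epsilon> by simp_all
    note est = tracking_value_estimate[OF pos assms(7) dg assms(5) continuous_on_layers[OF \<epsilon>]
        layer_adjoint_has_derivative[OF \<epsilon>] layer_state_has_derivative[OF \<epsilon>] layer_state_0]
    show ?thesis
      using est unfolding v_def G_def layer_energy_def by simp
  qed
  have sqrt_lim: "filterlim sqrt (at_right 0) (at_right (0::real))"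
    by real_asymp
  have lim_\<epsilon>: "((\<lambda>\<epsilon>. enn2real (v (\<epsilon>\<^sup>2)) / \<epsilon>) \<longlongrightarrow> C) (at_right 0)"
  proof -
    \<comment> \<open>The error bound of \<open>est\<close> divided by \<open>\<epsilon>\<close>,
      arranged so that every factor has a known limit.\<close>
    define R where "R = (\<lambda>\<epsilon>. 2 * \<epsilon> * G + (sqrt \<epsilon> * G + sqrt \<epsilon> * (layer_energy \<epsilon> / \<epsilon>)) / 2
      + (layer_adjoint \<epsilon> T / (\<epsilon> * sqrt \<epsilon>))\<^sup>2 * T)"
    have id0: "((\<lambda>\<epsilon>. \<epsilon>) \<longlongrightarrow> 0) (at_right (0::real))" by (rule tendsto_ident_at)
    have sqrt0: "(sqrt \<longlongrightarrow> 0) (at_right (0::real))" by real_asymp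
    have "(R \<longlongrightarrow> 2 * 0 * G + (0 * G + 0 * ((x - \<xi>\<^sub>0)\<^sup>2 + (\<Sum>j=1..N. (\<Delta> j)\<^sup>2) / 2)) / 2 + 0\<^sup>2 * T) (at_right 0)"
      unfolding R_def
      by (intro tendsto_intros id0 sqrt0 layer_energy_tendsto layer_adjoint_T_tendsto) auto
    then have R: "(R \<longlongrightarrow> 0) (at_right 0)" by simp
    have "((\<lambda>\<epsilon>. enn2real (v (\<epsilon>\<^sup>2)) / \<epsilon> - layer_energy \<epsilon> / \<epsilon> / 2) \<longlongrightarrow> 0) (at_right 0)"
    proof (rule Lim_null_comparison[OF _ R])
      show "eventually (\<lambda>\<epsilon>. norm (enn2real (v (\<epsilon>\<^sup>2)) / \<epsilon> - layer_energy \<epsilon> / \<epsilon> / 2) \<le> R \<epsilon>) (at_right 0)"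
      proof (rule eventually_at_right_less[THEN eventually_mono])
        fix \<epsilon> :: real assume \<epsilon>: "0 < \<epsilon>"
        have sq: "\<epsilon> = sqrt \<epsilon> * sqrt \<epsilon>" "sqrt \<epsilon> > 0" using \<epsilon> by simp_all
        have "enn2real (v (\<epsilon>\<^sup>2)) / \<epsilon> - layer_energy \<epsilon> / \<epsilon> / 2
            = (enn2real (v (\<epsilon>\<^sup>2)) - layer_energy \<epsilon> / 2) / \<epsilon>"
          by (simp add: diff_divide_distrib mult.commute)
        then have "norm (enn2real (v (\<epsilon>\<^sup>2)) / \<epsilon> - layer_energy \<epsilon> / \<epsilon> / 2)
            = \<bar>enn2real (v (\<epsilon>\<^sup>2)) - layer_energy \<epsilon> / 2\<bar> / \<epsilon>"
          using \<epsilon> by (simp only: real_norm_def abs_divide abs_of_pos)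
        also have "\<dots> \<le> (2 * \<epsilon>\<^sup>2 * G + (\<epsilon> * sqrt \<epsilon> * G + \<epsilon>\<^sup>2 * layer_energy \<epsilon> / (\<epsilon> * sqrt \<epsilon>)) / 2
            + (layer_adjoint \<epsilon> T)\<^sup>2 * T / \<epsilon>\<^sup>2) / \<epsilon>"
          using est[OF \<epsilon>] \<epsilon> by (intro divide_right_mono) auto
        also have "\<dots> = R \<epsilon>"
        proof -
          \<comment> \<open>Writing \<open>\<epsilon>\<close> as \<open>h * h\<close> removes the
            square roots and leaves a rational identity.\<close>
          define h where "h = sqrt \<epsilon>"
          have h: "h > 0" "\<epsilon> = h * h" using sq by (simp_all add: h_def)
          show ?thesis
            unfolding R_def h_def[symmetric] using h(1)
            by (simp add: h(2) field_simps power2_eq_square)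
        qed
        finally show "norm (enn2real (v (\<epsilon>\<^sup>2)) / \<epsilon> - layer_energy \<epsilon> / \<epsilon> / 2) \<le> R \<epsilon>" .
      qed
    qed
    from tendsto_add[OF this tendsto_divide[OF layer_energy_tendsto tendsto_const[of 2]]]
    have "((\<lambda>\<epsilon>. enn2real (v (\<epsilon>\<^sup>2)) / \<epsilon>) \<longlongrightarrow> ((x - \<xi>\<^sub>0)\<^sup>2 + (\<Sum>j=1..N. (\<Delta> j)\<^sup>2) / 2) / 2) (at_right 0)"
      by simp
    then show ?thesis by (simp add: C_def add_divide_distrib)
  qed
  have pos: "eventually (\<lambda>\<kappa>::real. 0 < \<kappa>) (at_right 0)"
    by (rule eventually_at_right_less)
  \<comment> \<open>Substitution of \<open>sqrt \<kappa>\<close> for \<open>\<epsilon>\<close>,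
    legitimate since the square root maps right neighbourhoods of 0 to such neighbourhoods.\<close>
  have lim: "((\<lambda>\<kappa>. enn2real (v \<kappa>) / sqrt \<kappa>) \<longlongrightarrow> C) (at_right 0)"
    by (rule Lim_transform_eventually[OF filterlim_compose[OF lim_\<epsilon> sqrt_lim]])
      (use pos in eventually_elim, simp)
  have "((\<lambda>\<kappa>. (enn2real (v \<kappa>) - sqrt \<kappa> * C) / sqrt \<kappa>) \<longlongrightarrow> 0) (at_right 0)"
  proof (rule Lim_transform_eventually)
    show "((\<lambda>\<kappa>. enn2real (v \<kappa>) / sqrt \<kappa> - C) \<longlongrightarrow> 0) (at_right 0)"
      using tendsto_diff[OF lim tendsto_const[of C]] by simp
    show "eventually (\<lambda>\<kappa>. enn2real (v \<kappa>) / sqrt \<kappa> - C = (enn2real (v \<kappa>) - sqrt \<kappa> * C) / sqrt \<kappa>) (at_right 0)"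
      using pos by eventually_elim (simp add: diff_divide_distrib)
  qed
  then have smallo: "(\<lambda>\<kappa>. enn2real (v \<kappa>) - sqrt \<kappa> * C) \<in> o[at_right 0](\<lambda>\<kappa>. sqrt \<kappa>)"
    by (rule smalloI_tendsto) (use pos in eventually_elim, simp)
  \<comment> \<open>A nonzero limit of the quotient bounds the value from both sides, which is the
    sense in which the rate is sharp; \<open>C\<close> is a positively weighted sum of
    squares.\<close>
  have "(\<lambda>\<kappa>. enn2real (v \<kappa>)) \<in> \<Theta>[at_right 0](\<lambda>\<kappa>. sqrt \<kappa>)"
    if "x \<noteq> \<xi>\<^sub>0 \<or> (\<exists>j\<in>{1..N}. \<Delta> j \<noteq> 0)"
  proof (rule bigthetaI_tendsto[OF _ lim])
    have nonneg: "(x - \<xi>\<^sub>0)\<^sup>2 \<ge> 0" "(\<Sum>j=1..N. (\<Delta> j)\<^sup>2) \<ge> 0"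
      by (auto intro: sum_nonneg)
    have "(x - \<xi>\<^sub>0)\<^sup>2 > 0 \<or> (\<Sum>j=1..N. (\<Delta> j)\<^sup>2) > 0"
      using that by (auto simp: zero_less_power2 intro: sum_pos2)
    with nonneg show "C \<noteq> 0"
      unfolding C_def by linarith
  qed
  \<comment> \<open>Finiteness of the value for all \<open>\<kappa>' \<ge> 0\<close> does not
    involve the layer width, so the instance with width 1 supplies it.\<close>
  with smallo est[of 1] show ?thesis
    unfolding C_def by simp
qed

end
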